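(* Let $\{X(n)\}_{n\ge 0}$ be an $\mathbb{R}^{\wp}$-valued process with $X(n)\sim\mu$ for every $n$, let $\{\mathcal{F}_{kl}\}$ be the family of $\sigma$-algebras, $F:(\mathbb{R}^{\wp})^{\ell}\to\mathbb{R}$ the function (with constants $\iota,K>0$, $\kappa\in(0,1]$) and $q_1<\dots<q_\ell$ the functions described in the context. Put $d=(\ell-1)\wp$ and suppose that there exist $p,q\ge 1$ and $\theta,m>0$ such that $\theta<\kappa-\frac dp$, $$\frac12\ \ge\ \frac1p+\frac{\iota+2}{m}+\frac{\theta}{q},\qquad \gamma_m+\gamma_{2q(\iota+2)}<\infty,$$ and the sequence $\varpi_{q,p}(n)+\beta_q(n)^{\theta}$, $n\ge 1$, is of size $-1/2$. Then with probability one $$\lim_{N\to\infty}\frac1N\sum_{n=1}^{N}F\big(X(q_1(n)),\dots,X(q_\ell(n))\big)=\bar F,$$ where $\bar F=\int F(x_1,\dots,x_\ell)\,d\mu(x_1)\cdots d\mu(x_\ell)$.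
   Context: Setup. $\ell,\wp\ge 1$ are integers. $\{X(n),\ n=0,1,\dots\}$ is a $\wp$-dimensional stochastic process on a probability space $(\Omega,\mathcal{F},P)$ such that the distribution $\mu$ of $X(n)$ does not depend on $n$ (stationarity is not required). $\mathcal{F}_{kl}\subset\mathcal{F}$, $0\le k\le l\le\infty$, are $\sigma$-algebras with $\mathcal{F}_{00}$ trivial and $\mathcal{F}_{kl}\subset\mathcal{F}_{k'l'}$ if $k'\le k$ and $l'\ge l$; for $-\infty\le k<0$ and $l\ge 0$ set $\mathcal{F}_{kl}=\mathcal{F}_{0l}$. $\|\cdot\|_r$ denotes the $L^r(\Omega,\mathcal{F},P)$-norm. Dependence and approximation coefficients. For sub-$\sigma$-algebras $\mathcal{G},\mathcal{H}\subset\mathcal{F}$, $$\varpi_{q,p}(\mathcal{G},\mathcal{H})=\sup\{\|E[g|\mathcal{G}]-E[g]\|_p:\ g \text{ real, } \mathcal{H}\text{-measurable, } \|g\|_q\le 1\},$$ $$\varpi_{q,p}(n)=\sup_{k\ge 0}\varpi_{q,p}(\mathcal{F}_{-\infty,k},\mathcal{F}_{k+n,\infty}),\qquad \beta_p(n)=\sup_{m\ge 0}\|X(m)-E(X(m)|\mathcal{F}_{m-n,m+n})\|_p.$$ Moments: for $r>0$, $\gamma_r^r=E|X(n)|^r=\int|x|^r\,d\mu$. Function $F$. For some $\iota,K>0$, $\kappa\in(0,1]$ and all $x_i,y_i\in\mathbb{R}^{\wp}$, $i=1,\dots,\ell$, $$|F(x_1,\dots,x_\ell)-F(y_1,\dots,y_\ell)|\le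 K\Big(1+\sum_{j=1}^\ell|x_j|^{\iota}+\sum_{j=1}^\ell|y_j|^{\iota}\Big)\sum_{j=1}^\ell|x_j-y_j|^{\kappa},$$ $$|F(x_1,\dots,x_\ell)|\le K\Big(1+\sum_{j=1}^\ell|x_j|^{\iota}\Big).$$ Functions $q_i$. $q_1(n)<q_2(n)<\dots<q_\ell(n)$ are positive functions taking integer values on integers such that for some $\varepsilon\in(0,1]$ and all $n\ge1$: $q_i(n)\ge q_{i-1}(n)+\varepsilon n$ for $i=2,\dots,\ell$, and $q_i(n+1)\ge q_i(n)+\varepsilon$ for $i=1,\dots,\ell$. Size. A sequence $\{a_n\}$ is of size $-1/2$ if there is a positive eventually nondecreasing sequence $\{L_n\}$ with $\sum_{n\ge1}(nL_n)^{-1}<\infty$, $L_n-L_{n-1}=O(L_n/n)$ and $a_n=O\big((n^{1/2}L_n)^{-1}\big)$. *)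

theory Defs
  imports
    "HOL-Probability.Probability"
    "HOL-Library.Landau_Symbols"
    "HOL-Library.Extended_Nat"
begin

text \<open>Powers of extended nonnegative numbers; used for exponents \<open>r > 0\<close> only.\<close>

definition ennpowr :: "ennreal \<Rightarrow> real \<Rightarrow> ennreal" where
  "ennpowr x r = (if x = \<top> then \<top> else ennreal (enn2real x powr r))"

definition Lr_norm :: "'w measure \<Rightarrow> real \<Rightarrow> ('w \<Rightarrow> 'b::real_normed_vector) \<Rightarrow> ennreal" where
  "Lr_norm M r f = ennpowr (\<integral>\<^sup>+\<omega>. ennreal (norm (f \<omega>) powr r) \<partial>M) (1 / r)"

text \<open>\<open>\<gamma>\<^sub>r\<close>, as a functional of the common distribution of the process.\<close>

definition gamma_moment :: "'b::real_normed_vector measure \<Rightarrow> real \<Rightarrow> ennreal" where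
  "gamma_moment \<mu> r = Lr_norm \<mu> r (\<lambda>x. x)"

text \<open>The library's conditional expectation is real-valued; for random vectors it is taken
  componentwise. Sub-\<open>\<sigma>\<close>-algebras are measures \<open>G\<close> with \<open>subalgebra M G\<close>.\<close>

definition vec_cond_exp ::
  "'w measure \<Rightarrow> 'w measure \<Rightarrow> ('w \<Rightarrow> real ^ 'd) \<Rightarrow> 'w \<Rightarrow> real ^ 'd" where
  "vec_cond_exp M G Y = (\<lambda>\<omega>. \<chi> i. real_cond_exp M G (\<lambda>\<omega>. Y \<omega> $ i) \<omega>)"

definition varpi_alg :: "'w measure \<Rightarrow> real \<Rightarrow> real \<Rightarrow> 'w measure \<Rightarrow> 'w measure \<Rightarrow> ennreal" where
  "varpi_alg M q p G H =
     (SUP g \<in> {g :: 'w \<Rightarrow> real. g \<in> borel_measurable H \<and> Lr_norm M q g \<le> 1}.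
        Lr_norm M p (\<lambda>\<omega>. real_cond_exp M G g \<omega> - integral\<^sup>L M g))"

text \<open>A family \<open>\<F>\<^sub>k\<^sub>l\<close>, \<open>0 \<le> k \<le> l \<le> \<infinity>\<close>. Its values for \<open>k > l\<close> are irrelevant.\<close>

definition sigma_family :: "'w measure \<Rightarrow> (enat \<Rightarrow> enat \<Rightarrow> 'w measure) \<Rightarrow> bool" where
  "sigma_family M \<F> \<longleftrightarrow>
     (\<forall>k l. k \<le> l \<longrightarrow> subalgebra M (\<F> k l)) \<and>
     sets (\<F> 0 0) = {{}, space M} \<and>
     (\<forall>k l k' l'. k \<le> l \<and> k' \<le> k \<and> l \<le> l' \<longrightarrow> sets (\<F> k l) \<subseteq> sets (\<F> k' l'))"

text \<open>The convention \<open>\<F>\<^sub>k\<^sub>l = \<F>\<^sub>0\<^sub>l\<close> for \<open>-\<infinity> \<le> k < 0\<close> enters twice: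
  \<open>\<F> 0 k\<close> stands for the algebra indexed by \<open>-\<infinity>, k\<close>, and the truncated subtraction
  \<open>m - n\<close> on \<^typ>\<open>nat\<close> is intended in \<open>beta_coeff\<close>.\<close>

definition varpi_coeff ::
  "'w measure \<Rightarrow> (enat \<Rightarrow> enat \<Rightarrow> 'w measure) \<Rightarrow> real \<Rightarrow> real \<Rightarrow> nat \<Rightarrow> ennreal" where
  "varpi_coeff M \<F> q p n = (SUP k :: nat. varpi_alg M q p (\<F> 0 (enat k)) (\<F> (enat (k + n)) \<infinity>))"

definition beta_coeff ::
  "'w measure \<Rightarrow> (enat \<Rightarrow> enat \<Rightarrow> 'w measure) \<Rightarrow> (nat \<Rightarrow> 'w \<Rightarrow> real ^ 'd) \<Rightarrow> real \<Rightarrow> nat \<Rightarrow> ennreal"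
  where
  "beta_coeff M \<F> X p n =
     (SUP m :: nat. Lr_norm M p
        (\<lambda>\<omega>. X m \<omega> - vec_cond_exp M (\<F> (enat (m - n)) (enat (m + n))) (X m) \<omega>))"

text \<open>Sequences indexed by \<open>n \<ge> 1\<close>; the values at \<open>0\<close> play no role (the term of the series at
  \<open>n = 0\<close> is \<open>1 / 0 = 0\<close>). A sequence of size \<open>-1/2\<close> is by definition one of real numbers,
  so all its terms are required to be finite.\<close>

definition size_minus_half :: "(nat \<Rightarrow> ennreal) \<Rightarrow> bool" where
  "size_minus_half a \<longleftrightarrow>
     (\<forall>n\<ge>1. a n < \<top>) \<and>
     (\<exists>L :: nat \<Rightarrow> real.
        (\<forall>n\<ge>1. 0 < L n) \<and>
        (\<exists>n0. \<forall>n\<ge>n0. L n \<le> L (Suc n)) \<and>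
        summable (\<lambda>n. 1 / (real n * L n)) \<and>
        (\<lambda>n. L n - L (n - 1)) \<in> O(\<lambda>n. L n / real n) \<and>
        (\<lambda>n. enn2real (a n)) \<in> O(\<lambda>n. 1 / (real n powr (1/2) * L n)))"

end

theory Submission
  imports Defs
begin

text \<open>
  The moment of order \<open>2 (\<iota> + 2)\<close> of \<open>\<mu>\<close> is finite, since \<open>m \<ge> 2 (\<iota> + 2)\<close>, and
  both \<open>\<varpi>\<^sub>q\<^sub>,\<^sub>p(n)\<close> and \<open>\<beta>\<^sub>q(n)\<close> are \<open>O(n\<^sup>-\<^sup>1\<^sup>/\<^sup>2)\<close>, so that mixing and approximation hold at that rate
  in \<open>L\<^sup>1\<close>. If \<open>f\<close> is bounded, Lipschitz and \<open>\<mu>\<close>-centred and \<open>U n\<close> depends on the process up to a time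
  before \<open>s n\<close>, then \<open>Z n = U n * f (X (s n))\<close> satisfies \<open>E (Z n * Z m) = O(|n - m|\<^sup>-\<^sup>1\<^sup>/\<^sup>2)\<close>, because the
  latest factor can be decoupled from all the others. Hence \<open>E (Z 1 + \<dots> + Z N)\<^sup>2 = O(N\<^sup>3\<^sup>/\<^sup>2)\<close>, and the
  strong law follows along \<open>N = k\<^sup>4\<close> and then for all \<open>N\<close>. Replacing the factors by their means one at a
  time gives the theorem when \<open>F\<close> is a product of bounded Lipschitz functions of the single
  coordinates, hence for the algebra these generate. By Stone-Weierstrass this algebra approximates
  \<open>F\<close> composed with the projection of every coordinate to a ball of radius \<open>R\<close>. The truncation
  error is at most \<open>O(1 / R)\<close> times \<open>1 + |x 1|\<^sup>t + \<dots> + |x l|\<^sup>t\<close> with \<open>t \<ge> \<iota> + 1\<close>, whose averages along the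
  process stay bounded almost surely.
\<close>

subsection \<open>Second moments and strong laws\<close>

text \<open>The coefficients are given in \<open>L^q\<close> and \<open>L^p\<close>. This brings
  them to \<open>L^1\<close>, the norm in which dependence is measured in the locale
  \<open>weakly_dependent_process\<close>.\<close>

lemma nn_integral_norm_le_Lr_norm:
  fixes f :: "'w \<Rightarrow> 'b::real_normed_vector"
  assumes "prob_space M" and [measurable]: "(\<lambda>\<omega>. norm (f \<omega>)) \<in> borel_measurable M"
    and r: "1 \<le> r" and a: "0 < a" and le: "Lr_norm M r f \<le> ennreal a"
  shows "(\<integral>\<^sup>+\<omega>. ennreal (norm (f \<omega>)) \<partial>M) \<le> ennreal (2 * a)"
proof -
  interpret prob_space M by fact
  define I where "I = (\<integral>\<^sup>+\<omega>. ennreal (norm (f \<omega>) powr r) \<partial>M)"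
  have I: "ennpowr I (1 / r) \<le> ennreal a"
    using le by (simp add: Lr_norm_def I_def)
  have fin: "I \<noteq> \<top>"
    using I by (auto simp: ennpowr_def top_unique)
  have "enn2real I powr (1 / r) \<le> a"
    using I fin a by (simp add: ennpowr_def)
  then have "(enn2real I powr (1 / r)) powr r \<le> a powr r"
    using r by (intro powr_mono2) auto
  then have "enn2real I \<le> a powr r"
    using r by (simp add: powr_powr)
  then have Ile: "I \<le> ennreal (a powr r)"
    using fin by (metis ennreal_enn2real ennreal_leI less_top)
  \<comment> \<open>A substitute for Jensen's inequality that costs a factor \<open>2\<close>.\<close>
  have pt: "norm (f \<omega>) \<le> a + a powr (1 - r) * norm (f \<omega>) powr r" for \<omega>
  proof (cases "norm (f \<omega>) \<le> a")
    case True
    then show ?thesis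
      using a by (simp add: add_increasing2)
  next
    case False
    then have "norm (f \<omega>) = norm (f \<omega>) powr (1 - r) * norm (f \<omega>) powr r"
      using a by (simp flip: powr_add)
    also have "\<dots> \<le> a powr (1 - r) * norm (f \<omega>) powr r"
      using False r a by (intro mult_right_mono powr_mono2') auto
    finally show ?thesis
      using a by linarith
  qed
  have "(\<integral>\<^sup>+\<omega>. ennreal (norm (f \<omega>)) \<partial>M)
      \<le> (\<integral>\<^sup>+\<omega>. ennreal a + ennreal (a powr (1 - r)) * ennreal (norm (f \<omega>) powr r) \<partial>M)"
    using pt a by (intro nn_integral_mono) (simp flip: ennreal_mult' ennreal_plus)
  also have "\<dots> = ennreal a + ennreal (a powr (1 - r)) * I"
    by (simp add: nn_integral_add nn_integral_cmult I_def emeasure_space_1)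
  also have "\<dots> \<le> ennreal a + ennreal (a powr (1 - r)) * ennreal (a powr r)"
    using Ile by (intro add_left_mono mult_left_mono) auto
  also have "\<dots> = ennreal (2 * a)"
    using a by (simp flip: ennreal_mult' ennreal_plus powr_add)
  finally show ?thesis .
qed

text \<open>The series over \<open>k\<close> has finite expectation, so it converges almost surely
  and its terms tend to 0. This takes the place of a Borel-Cantelli argument.\<close>

lemma AE_tendsto_0_of_summable:
  fixes Y :: "nat \<Rightarrow> 'w \<Rightarrow> real"
  assumes [measurable]: "\<And>k. Y k \<in> borel_measurable M"
    and nn: "\<And>k \<omega>. 0 \<le> Y k \<omega>"
    and le: "\<And>k. (\<integral>\<^sup>+\<omega>. ennreal (Y k \<omega>) \<partial>M) \<le> ennreal (b k)"
    and b: "\<And>k. 0 \<le> b k" "summable b"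
  shows "AE \<omega> in M. (\<lambda>k. Y k \<omega>) \<longlonglongrightarrow> 0"
proof -
  have "(\<integral>\<^sup>+\<omega>. (\<Sum>k. ennreal (Y k \<omega>)) \<partial>M) = (\<Sum>k. \<integral>\<^sup>+\<omega>. ennreal (Y k \<omega>) \<partial>M)"
    by (intro nn_integral_suminf) auto
  also have "\<dots> \<le> (\<Sum>k. ennreal (b k))"
    by (intro suminf_le le) auto
  also have "\<dots> < \<infinity>"
    using b by (simp add: suminf_ennreal2)
  finally have "AE \<omega> in M. (\<Sum>k. ennreal (Y k \<omega>)) \<noteq> \<infinity>"
    by (intro nn_integral_PInf_AE) auto
  then show ?thesis
  proof eventually_elim
    case (elim \<omega>)
    then have "summable (\<lambda>k. Y k \<omega>)"
      using nn by (intro summable_suminf_not_top) auto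
    then show ?case
      by (rule summable_LIMSEQ_zero)
  qed
qed

text \<open>With \<open>a = sqrt N\<close> and \<open>b = sqrt (N + 1)\<close>, the inequality
  \<open>2 * a * b <= a^2 + b^2\<close> and \<open>b^2 = a^2 + 1\<close> give
  \<open>1 / b <= 2 * (b - a)\<close>, and these increments telescope.\<close>

lemma sum_inverse_sqrt_le: "(\<Sum>j=1..N. 1 / sqrt (real j)) \<le> 2 * sqrt (real N)"
proof (induction N)
  case (Suc N)
  define a b where "a = sqrt (real N)" and "b = sqrt (real (Suc N))"
  have ab: "b > 0" "a \<ge> 0" "b\<^sup>2 = a\<^sup>2 + 1"
    by (auto simp: a_def b_def)
  have "2 * a * b \<le> a\<^sup>2 + b\<^sup>2"
    using sum_squares_bound[of a b] by simp
  then have "2 * a * b + 1 \<le> 2 * b * b"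
    using ab by (simp add: power2_eq_square)
  then have "2 * a + 1 / b \<le> 2 * b"
    using ab by (simp add: field_simps)
  then show ?case
    using Suc.IH by (simp add: a_def b_def)
qed simp

text \<open>Passing from \<open>N\<close> to \<open>N + 1\<close> adds a diagonal term of at most
  \<open>D^2\<close> and twice a sum of covariances, which is at most \<open>2 * A * sqrt N\<close>.
  Each step therefore costs at most \<open>(D^2 + 4 * A) * sqrt (N + 1)\<close>.\<close>

lemma (in prob_space) second_moment_sum_le:
  fixes Z :: "nat \<Rightarrow> 'a \<Rightarrow> real"
  assumes [measurable]: "\<And>n. 1 \<le> n \<Longrightarrow> Z n \<in> borel_measurable M"
    and D: "\<And>n \<omega>. 1 \<le> n \<Longrightarrow> \<bar>Z n \<omega>\<bar> \<le> D"
    and cov: "\<And>n m. 1 \<le> n \<Longrightarrow> n < m \<Longrightarrow> \<bar>expectation (\<lambda>\<omega>. Z n \<omega> * Z m \<omega>)\<bar> \<le> A / sqrt (real (m - n))"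
    and A: "0 \<le> A"
  shows "expectation (\<lambda>\<omega>. (\<Sum>n=1..N. Z n \<omega>)\<^sup>2) \<le> (D\<^sup>2 + 4 * A) * (real N * sqrt (real N))"
proof (induction N)
  case (Suc N)
  have D0: "0 \<le> D"
    using D[of 1 undefined] by linarith
  have int: "integrable M (\<lambda>\<omega>. Z n \<omega> * Z k \<omega>)" if "1 \<le> n" "1 \<le> k" for n k
    using D[OF that(1)] D[OF that(2)] that D0
    by (intro integrable_const_bound[where B="D * D"]) (auto simp: abs_mult intro!: mult_mono)
  have intS: "integrable M (\<lambda>\<omega>. (\<Sum>n=1..N. Z n \<omega>)\<^sup>2)"
    unfolding power2_eq_square sum_product by (intro Bochner_Integration.integrable_sum int) auto
  have intC: "integrable M (\<lambda>\<omega>. \<Sum>n=1..N. Z n \<omega> * Z (Suc N) \<omega>)"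
    by (intro Bochner_Integration.integrable_sum int) auto
  have exC: "expectation (\<lambda>\<omega>. \<Sum>n=1..N. Z n \<omega> * Z (Suc N) \<omega>)
      = (\<Sum>n=1..N. expectation (\<lambda>\<omega>. Z n \<omega> * Z (Suc N) \<omega>))"
    by (intro Bochner_Integration.integral_sum int) auto
  have sq: "integrable M (\<lambda>\<omega>. (Z (Suc N) \<omega>)\<^sup>2)"
    unfolding power2_eq_square by (intro int) auto
  have "expectation (\<lambda>\<omega>. (\<Sum>n=1..Suc N. Z n \<omega>)\<^sup>2) =
      expectation (\<lambda>\<omega>. (\<Sum>n=1..N. Z n \<omega>)\<^sup>2 + 2 * (\<Sum>n=1..N. Z n \<omega> * Z (Suc N) \<omega>) + (Z (Suc N) \<omega>)\<^sup>2)"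
    by (simp add: power2_sum algebra_simps flip: sum_distrib_right)
  also have "\<dots> = expectation (\<lambda>\<omega>. (\<Sum>n=1..N. Z n \<omega>)\<^sup>2)
      + 2 * (\<Sum>n=1..N. expectation (\<lambda>\<omega>. Z n \<omega> * Z (Suc N) \<omega>)) + expectation (\<lambda>\<omega>. (Z (Suc N) \<omega>)\<^sup>2)"
    unfolding exC[symmetric] using intS sq intC by simp
  finally have E: "expectation (\<lambda>\<omega>. (\<Sum>n=1..Suc N. Z n \<omega>)\<^sup>2) = expectation (\<lambda>\<omega>. (\<Sum>n=1..N. Z n \<omega>)\<^sup>2)
      + 2 * (\<Sum>n=1..N. expectation (\<lambda>\<omega>. Z n \<omega> * Z (Suc N) \<omega>)) + expectation (\<lambda>\<omega>. (Z (Suc N) \<omega>)\<^sup>2)" .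
  have diag: "expectation (\<lambda>\<omega>. (Z (Suc N) \<omega>)\<^sup>2) \<le> D\<^sup>2"
    using sq D[of "Suc N"] by (intro integral_le_const) (auto intro!: AE_I2 power2_le_iff_abs_le[THEN iffD2] simp: D0)
  have "(\<Sum>n=1..N. expectation (\<lambda>\<omega>. Z n \<omega> * Z (Suc N) \<omega>)) \<le> (\<Sum>n=1..N. A / sqrt (real (Suc N - n)))"
    by (rule sum_mono, rule abs_le_D1, rule cov) auto
  \<comment> \<open>The substitution \<open>j = Suc N - n\<close> uses the distance to the newest
    index as summation variable.\<close>
  also have "\<dots> = A * (\<Sum>j=1..N. 1 / sqrt (real j))"
    unfolding sum_distrib_left
    by (rule sum.reindex_bij_witness[where i="\<lambda>j. Suc N - j" and j="\<lambda>j. Suc N - j"]) auto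
  also have "\<dots> \<le> A * (2 * sqrt (real N))"
    using A sum_inverse_sqrt_le by (intro mult_left_mono)
  finally have "expectation (\<lambda>\<omega>. (\<Sum>n=1..Suc N. Z n \<omega>)\<^sup>2)
     \<le> (D\<^sup>2 + 4 * A) * (real N * sqrt (real N)) + 2 * (A * (2 * sqrt (real N))) + D\<^sup>2"
    using E Suc.IH diag by linarith
  also have "\<dots> \<le> (D\<^sup>2 + 4 * A) * (real N * sqrt (real N)) + 4 * A * sqrt (real (Suc N)) + D\<^sup>2 * sqrt (real (Suc N))"
    using A mult_left_mono[of "sqrt N" "sqrt (Suc N)" "4 * A"] mult_left_mono[of 1 "sqrt (Suc N)" "D\<^sup>2"] by simp
  also have "\<dots> \<le> (D\<^sup>2 + 4 * A) * (real N * sqrt (real (Suc N))) + 4 * A * sqrt (real (Suc N)) + D\<^sup>2 * sqrt (real (Suc N))"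
    using A by (intro add_right_mono mult_left_mono) auto
  also have "\<dots> = (D\<^sup>2 + 4 * A) * (real (Suc N) * sqrt (real (Suc N)))"
    by (simp add: algebra_simps)
  finally show ?case .
qed simp

lemma nat_power_bracket:
  fixes N K e :: nat
  assumes "K ^ e \<le> N" "0 < e"
  obtains k where "K \<le> k" "k ^ e \<le> N" "N < Suc k ^ e"
proof -
  have bdd: "k \<le> N" if "k ^ e \<le> N" for k
    using that \<open>0 < e\<close> self_le_power[of k e] by (cases "k = 0") auto
  let ?P = "\<lambda>k. k ^ e \<le> N"
  define k where "k = Greatest ?P"
  have "?P k"
    unfolding k_def using assms(1) bdd by (rule GreatestI_nat[where P="?P"])
  moreover have "K \<le> k"
    unfolding k_def using assms(1) bdd by (rule Greatest_le_nat[where P="?P"])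
  moreover have "\<not> ?P (Suc k)"
    using Greatest_le_nat[where P="?P", OF _ bdd, of "Suc k"] unfolding k_def by fastforce
  ultimately show ?thesis
    using that by force
qed

text \<open>Between \<open>k^4\<close> and \<open>(k + 1)^4\<close> there are only
  \<open>O(k^3)\<close> terms, each bounded by \<open>D\<close>; after division by
  \<open>N >= k^4\<close> they are negligible.\<close>

lemma average_tendsto_0_of_fourth_powers:
  fixes z :: "nat \<Rightarrow> real"
  assumes D: "\<And>n. 1 \<le> n \<Longrightarrow> \<bar>z n\<bar> \<le> D"
    and lim: "(\<lambda>k. (\<Sum>n=1..k ^ 4. z n) / real (k ^ 4)) \<longlonglongrightarrow> 0"
  shows "(\<lambda>N. 1 / real N * (\<Sum>n=1..N. z n)) \<longlonglongrightarrow> 0"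
proof (rule LIMSEQ_I)
  fix e :: real
  assume e: "0 < e"
  have D0: "0 \<le> D"
    using D[of 1] by linarith
  obtain K1 where K1: "\<And>k. k \<ge> K1 \<Longrightarrow> \<bar>(\<Sum>n=1..k ^ 4. z n) / real (k ^ 4)\<bar> < e / 2"
    using LIMSEQ_D[OF lim, of "e / 2"] e by auto
  \<comment> \<open>For \<open>k >= 30 * D / e\<close> the bound \<open>15 * k^3 * D\<close> on the
    terms beyond \<open>k^4\<close> is at most \<open>e / 2 * k^4\<close>.\<close>
  obtain K2 :: nat where K2: "30 * D / e < real K2"
    using reals_Archimedean2 by blast
  define K where "K = Suc (max K1 K2)"
  show "\<exists>no. \<forall>N\<ge>no. norm (1 / real N * (\<Sum>n=1..N. z n) - 0) < e"
  proof (intro exI allI impI)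
    fix N
    assume "K ^ 4 \<le> N"
    then obtain k where k: "K \<le> k" "k ^ 4 \<le> N" "N < Suc k ^ 4"
      by (rule nat_power_bracket) auto
    have k1: "1 \<le> real k" and kK: "K1 \<le> k" "real K2 \<le> real k"
      using k(1) by (auto simp: K_def)
    have N0: "0 < real N"
      using k(2) k1 by (metis gr_zeroI le_zero_eq not_one_le_zero of_nat_0_less_iff of_nat_1 of_nat_le_iff power_eq_0_iff)
    have "\<bar>(\<Sum>n=1..k ^ 4. z n)\<bar> < e / 2 * real (k ^ 4)"
      using K1[OF kK(1)] k1 by (simp add: abs_divide pos_divide_less_eq)
    moreover have "(\<Sum>n=1..N. z n) = (\<Sum>n=1..k ^ 4. z n) + (\<Sum>n=Suc (k ^ 4)..N. z n)"
      using sum.ub_add_nat[of 1 "k ^ 4" z "N - k ^ 4"] k(2) by simp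
    moreover have "\<bar>\<Sum>n=Suc (k ^ 4)..N. z n\<bar> \<le> e / 2 * real (k ^ 4)"
    proof -
      have "\<bar>\<Sum>n=Suc (k ^ 4)..N. z n\<bar> \<le> (\<Sum>n=Suc (k ^ 4)..N. D)"
        by (rule order_trans[OF sum_abs sum_mono]) (use D in auto)
      also have "\<dots> = (real N - real (k ^ 4)) * D"
        using k(2) by (simp add: of_nat_diff)
      also have "real N \<le> real (Suc k ^ 4)"
        using k(3) by linarith
      also have "real (Suc k ^ 4) = (1 + real k) ^ 4"
        by simp
      \<comment> \<open>The difference is \<open>4 * k^3 + 6 * k^2 + 4 * k + 1\<close>; the
        coefficients add up to 15, and the lower powers are at most \<open>k^3\<close> because
        \<open>1 <= k\<close>.\<close>
      also have "(1 + real k) ^ 4 - real (k ^ 4) \<le> 15 * real k ^ 3"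
      proof -
        have "real k \<le> real k ^ 3" "real k ^ 2 \<le> real k ^ 3" "1 \<le> real k ^ 3"
          using k1 by (auto intro: self_le_power power_increasing)
        then show ?thesis
          by (simp add: power4_eq_xxxx power3_eq_cube power2_eq_square algebra_simps)
      qed
      finally have "\<bar>\<Sum>n=Suc (k ^ 4)..N. z n\<bar> \<le> 15 * real k ^ 3 * D"
        using D0 by (simp add: mult_right_mono)
      also have "\<dots> = 15 * D * real k ^ 3"
        by simp
      also have "15 * D \<le> e / 2 * real k"
        using less_le_trans[OF K2 kK(2)] e by (simp add: field_simps)
      finally show ?thesis
        by (simp add: mult_right_mono power4_eq_xxxx power3_eq_cube algebra_simps)
    qed
    ultimately have "\<bar>\<Sum>n=1..N. z n\<bar> < e * real (k ^ 4)"
      by linarith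
    also have "\<dots> \<le> e * real N"
      using k(2) e by (intro mult_left_mono) (auto simp flip: of_nat_power)
    finally show "norm (1 / real N * (\<Sum>n=1..N. z n) - 0) < e"
      using N0 by (simp add: abs_mult field_simps)
  qed
qed

text \<open>At \<open>N = k^4\<close> the second moment of the average is at most
  \<open>A / sqrt N = A / k^2\<close>. This is summable, so the averages tend to 0 along fourth
  powers, and boundedness of the terms fills the gaps.\<close>

lemma (in prob_space) slln_of_second_moment:
  fixes Z :: "nat \<Rightarrow> 'a \<Rightarrow> real"
  assumes [measurable]: "\<And>n. 1 \<le> n \<Longrightarrow> Z n \<in> borel_measurable M"
    and D: "\<And>n \<omega>. 1 \<le> n \<Longrightarrow> \<bar>Z n \<omega>\<bar> \<le> D"
    and A: "\<And>N. expectation (\<lambda>\<omega>. (\<Sum>n=1..N. Z n \<omega>)\<^sup>2) \<le> A * (real N * sqrt (real N))"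
  shows "AE \<omega> in M. (\<lambda>N. 1 / real N * (\<Sum>n=1..N. Z n \<omega>)) \<longlonglongrightarrow> 0"
proof -
  have A0: "0 \<le> A"
    using order_trans[OF _ A[of 1], of 0] by (simp add: integral_nonneg_AE)
  have meas[measurable]: "(\<lambda>\<omega>. \<Sum>n=1..N. Z n \<omega>) \<in> borel_measurable M" for N
    by (intro borel_measurable_sum) auto
  have int: "integrable M (\<lambda>\<omega>. (\<Sum>n=1..N. Z n \<omega>)\<^sup>2)" for N
  proof (rule integrable_const_bound[where B="(\<Sum>n=1..N. D)\<^sup>2"])
    have "\<bar>\<Sum>n=1..N. Z n \<omega>\<bar> \<le> (\<Sum>n=1..N. D)" for \<omega>
      by (rule order_trans[OF sum_abs sum_mono]) (use D in auto)
    then show "AE \<omega> in M. norm ((\<Sum>n=1..N. Z n \<omega>)\<^sup>2) \<le> (\<Sum>n=1..N. D)\<^sup>2"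
      by (intro AE_I2) (metis abs_ge_zero norm_power power2_abs power_mono real_norm_def)
  qed simp
  have "AE \<omega> in M. (\<lambda>k. ((\<Sum>n=1..k ^ 4. Z n \<omega>) / real (k ^ 4))\<^sup>2) \<longlonglongrightarrow> 0"
  proof (rule AE_tendsto_0_of_summable)
    fix k :: nat
    have "(\<integral>\<^sup>+\<omega>. ennreal (((\<Sum>n=1..k ^ 4. Z n \<omega>) / real (k ^ 4))\<^sup>2) \<partial>M)
        = ennreal (expectation (\<lambda>\<omega>. (\<Sum>n=1..k ^ 4. Z n \<omega>)\<^sup>2 / real (k ^ 4) ^ 2))"
      using int[of "k ^ 4"] unfolding power_divide
      by (intro nn_integral_eq_integral) auto
    also have "\<dots> \<le> ennreal (A * (real (k ^ 4) * sqrt (real (k ^ 4))) / real (k ^ 4) ^ 2)"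
      unfolding integral_divide_zero using A[of "k ^ 4"] by (intro ennreal_leI divide_right_mono) auto
    also have "sqrt (real (k ^ 4)) = real k ^ 2"
      by (rule real_sqrt_unique) (auto simp flip: power_mult)
    also have "A * (real (k ^ 4) * real k ^ 2) / real (k ^ 4) ^ 2 = A * (1 / real k ^ 2)"
      by (cases "k = 0") (simp_all add: divide_simps eval_nat_numeral)
    finally show "(\<integral>\<^sup>+\<omega>. ennreal (((\<Sum>n=1..k ^ 4. Z n \<omega>) / real (k ^ 4))\<^sup>2) \<partial>M) \<le> ennreal (A * (1 / real k ^ 2))" .
    show "0 \<le> A * (1 / real k ^ 2)"
      using A0 by simp
  next
    show "summable (\<lambda>k. A * (1 / real k ^ 2))"
      using inverse_power_summable[of 2, where 'a=real] by (intro summable_mult) (simp add: inverse_eq_divide)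
  qed auto
  then show ?thesis
  proof eventually_elim
    case (elim \<omega>)
    then have "(\<lambda>k. \<bar>(\<Sum>n=1..k ^ 4. Z n \<omega>) / real (k ^ 4)\<bar>) \<longlonglongrightarrow> 0"
      using tendsto_real_sqrt[OF elim] by simp
    then show ?case
      using D by (intro average_tendsto_0_of_fourth_powers[OF _ tendsto_rabs_zero_cancel])
  qed
qed

subsection \<open>Decoupling\<close>

text \<open>The constants are parameters because later bounds may depend on \<open>f\<close> only
  through them, as in \<open>second_moment_bound\<close>.\<close>

definition bdd_lipschitz :: "real \<Rightarrow> real \<Rightarrow> ('b::real_normed_vector \<Rightarrow> real) \<Rightarrow> bool" where
  "bdd_lipschitz B L f \<longleftrightarrow> 0 \<le> B \<and> 0 \<le> L \<and> (\<forall>x. \<bar>f x\<bar> \<le> B) \<and> (\<forall>x y. \<bar>f x - f y\<bar> \<le> L * norm (x - y))"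

lemma bdd_lipschitzD:
  assumes "bdd_lipschitz B L f"
  shows "\<bar>f x\<bar> \<le> B" "\<bar>f x - f y\<bar> \<le> L * norm (x - y)" "0 \<le> B" "0 \<le> L"
  using assms by (auto simp: bdd_lipschitz_def)

lemma bdd_lipschitz_continuous:
  assumes "bdd_lipschitz B L f"
  shows "continuous_on UNIV f"
  using assms
  by (intro lipschitz_on_continuous_on[where L=L]) (auto simp: bdd_lipschitz_def lipschitz_on_def dist_norm)

lemma bdd_lipschitz_measurable:
  assumes "bdd_lipschitz B L f"
  shows "f \<in> borel_measurable borel"
  using bdd_lipschitz_continuous[OF assms] by (rule borel_measurable_continuous_onI)

lemma bdd_lipschitz_const: "bdd_lipschitz \<bar>c\<bar> 0 (\<lambda>_. c)"
  by (auto simp: bdd_lipschitz_def)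

lemma abs_mult_diff_le:
  fixes a b a' b' :: real
  assumes "\<bar>a\<bar> \<le> A" "\<bar>b'\<bar> \<le> B"
  shows "\<bar>a * b - a' * b'\<bar> \<le> A * \<bar>b - b'\<bar> + B * \<bar>a - a'\<bar>"
proof -
  have "a * b - a' * b' = a * (b - b') + b' * (a - a')"
    by (simp add: algebra_simps)
  also have "\<bar>\<dots>\<bar> \<le> \<bar>a\<bar> * \<bar>b - b'\<bar> + \<bar>b'\<bar> * \<bar>a - a'\<bar>"
    by (metis abs_mult abs_triangle_ineq)
  also have "\<dots> \<le> A * \<bar>b - b'\<bar> + B * \<bar>a - a'\<bar>"
    using assms by (intro add_mono mult_right_mono) auto
  finally show ?thesis .
qed

lemma bdd_lipschitz_mult:
  assumes f: "bdd_lipschitz A L f" and g: "bdd_lipschitz B K g"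
  shows "bdd_lipschitz (A * B) (A * K + B * L) (\<lambda>x. f x * g x)"
  unfolding bdd_lipschitz_def
proof (intro conjI allI)
  note fD = bdd_lipschitzD[OF f] and gD = bdd_lipschitzD[OF g]
  show "0 \<le> A * B" "0 \<le> A * K + B * L"
    using fD gD by auto
  fix x y
  show "\<bar>f x * g x\<bar> \<le> A * B"
    unfolding abs_mult using fD(1,3) gD(1,3) by (intro mult_mono) auto
  have "\<bar>f x * g x - f y * g y\<bar> \<le> A * \<bar>g x - g y\<bar> + B * \<bar>f x - f y\<bar>"
    using fD(1) gD(1) by (rule abs_mult_diff_le)
  also have "\<dots> \<le> A * (K * norm (x - y)) + B * (L * norm (x - y))"
    using fD gD by (intro add_mono mult_left_mono) auto
  finally show "\<bar>f x * g x - f y * g y\<bar> \<le> (A * K + B * L) * norm (x - y)"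
    by (simp add: algebra_simps)
qed

text \<open>\<open>V s r\<close> plays the role of \<open>E(X(s) | \<F>\<^sub>s\<^sub>-\<^sub>r\<^sub>,\<^sub>s\<^sub>+\<^sub>r)\<close>, with truncated subtraction \<open>s - r\<close> as in
  \<^const>\<open>beta_coeff\<close>.\<close>

locale weakly_dependent_process = prob_space M
  for M :: "'w measure" +
  fixes X :: "nat \<Rightarrow> 'w \<Rightarrow> 'b::euclidean_space"
    and V :: "nat \<Rightarrow> nat \<Rightarrow> 'w \<Rightarrow> 'b"
    and \<F> :: "enat \<Rightarrow> enat \<Rightarrow> 'w measure"
    and \<mu> :: "'b measure"
    and C :: real
  assumes X_meas[measurable]: "X n \<in> borel_measurable M"
    and X_distr: "distr M borel (X n) = \<mu>"
    and C_nonneg: "0 \<le> C"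
    and subalg: "k \<le> l \<Longrightarrow> subalgebra M (\<F> k l)"
    and F_mono: "k \<le> l \<Longrightarrow> k' \<le> k \<Longrightarrow> l \<le> l' \<Longrightarrow> sets (\<F> k l) \<subseteq> sets (\<F> k' l')"
    and V_meas: "1 \<le> r \<Longrightarrow> V s r \<in> borel_measurable (\<F> (enat (s - r)) (enat (s + r)))"
    and V_dist: "1 \<le> r \<Longrightarrow> (\<integral>\<^sup>+\<omega>. ennreal (norm (X s \<omega> - V s r \<omega>)) \<partial>M) \<le> ennreal (C / sqrt (real r))"
    and mixing: "1 \<le> n \<Longrightarrow> g \<in> borel_measurable (\<F> (enat (j + n)) \<infinity>) \<Longrightarrow> (\<And>\<omega>. \<bar>g \<omega>\<bar> \<le> 1) \<Longrightarrow>
      (\<integral>\<^sup>+\<omega>. ennreal \<bar>real_cond_exp M (\<F> 0 (enat j)) g \<omega> - integral\<^sup>L M g\<bar> \<partial>M) \<le> ennreal (C / sqrt (real n))"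
begin

section \<open>Approximation by the past, and covariances under mixing\<close>

lemma integrable_bounded:
  fixes g :: "'w \<Rightarrow> real"
  assumes "g \<in> borel_measurable M" "\<And>\<omega>. \<bar>g \<omega>\<bar> \<le> B"
  shows "integrable M g"
  using assms by (intro integrable_const_bound[where B=B]) auto

lemma F_measurable_mono:
  assumes "g \<in> borel_measurable (\<F> k l)" "k \<le> l" "k' \<le> k" "l \<le> l'"
  shows "g \<in> borel_measurable (\<F> k' l')"
proof -
  have "k' \<le> l'"
    using assms by order
  then have "subalgebra (\<F> k' l') (\<F> k l)"
    using subalg[of k l] subalg[of k' l'] F_mono[OF assms(2-4)] assms(2) by (auto simp: subalgebra_def)
  then show ?thesis
    using assms(1) by (rule measurable_from_subalg)
qed

lemma F_measurable:
  assumes "g \<in> borel_measurable (\<F> k l)" "k \<le> l"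
  shows "g \<in> borel_measurable M"
  using subalg[OF assms(2)] assms(1) by (rule measurable_from_subalg)

lemma V_measurable: "1 \<le> r \<Longrightarrow> V s r \<in> borel_measurable M"
  by (rule F_measurable[OF V_meas]) auto

lemma expectation_eq: "f \<in> borel_measurable borel \<Longrightarrow> expectation (\<lambda>\<omega>. f (X s \<omega>)) = (\<integral>x. f x \<partial>\<mu>)"
  for f :: "'b \<Rightarrow> real"
  unfolding X_distr[of s, symmetric] by (subst integral_distr) auto

lemma sets_mu[measurable_cong]: "sets \<mu> = sets borel" and space_mu: "space \<mu> = UNIV"
  unfolding X_distr[of 0, symmetric] by auto

lemma prob_space_mu: "prob_space \<mu>"
  unfolding X_distr[of 0, symmetric] by (rule prob_space_distr) auto

text \<open>As \<open>W\<close> is measurable for the past algebra, \<open>g\<close> may be replaced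
  by its conditional expectation \<open>h\<close> under the integral. The covariance is then at most
  \<open>D\<close> times the \<open>L^1\<close> distance of \<open>h\<close> from the mean of
  \<open>g\<close>, which \<open>mixing\<close> controls.\<close>

lemma mixing_covariance:
  assumes n: "1 \<le> n"
    and W: "W \<in> borel_measurable (\<F> 0 (enat k))" "\<And>\<omega>. \<bar>W \<omega>\<bar> \<le> D"
    and g: "g \<in> borel_measurable (\<F> (enat (k + n)) \<infinity>)" "\<And>\<omega>. \<bar>g \<omega>\<bar> \<le> 1"
  shows "\<bar>expectation (\<lambda>\<omega>. W \<omega> * g \<omega>) - expectation W * expectation g\<bar> \<le> D * C / sqrt (real n)"
proof -
  interpret G: finite_measure_subalgebra M "\<F> 0 (enat k)"
    by unfold_locales (rule subalg, simp)
  define h where "h = real_cond_exp M (\<F> 0 (enat k)) g"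
  have D0: "0 \<le> D"
    using W(2)[of undefined] by linarith
  have gM[measurable]: "g \<in> borel_measurable M" and WM[measurable]: "W \<in> borel_measurable M"
    using g W by (auto intro: F_measurable)
  have intg: "integrable M g" and intW: "integrable M W"
    using integrable_bounded[OF gM g(2)] integrable_bounded[OF WM W(2)] .
  have intWg: "integrable M (\<lambda>\<omega>. W \<omega> * g \<omega>)"
    using W(2) g(2) D0 by (intro integrable_bounded[where B="D * 1"]) (auto simp only: abs_mult intro!: mult_mono borel_measurable_times gM WM)
  have inth: "integrable M h"
    unfolding h_def using intg by (rule G.real_cond_exp_int)
  have intWh: "integrable M (\<lambda>\<omega>. W \<omega> * h \<omega>)" and eq: "expectation (\<lambda>\<omega>. W \<omega> * h \<omega>) = expectation (\<lambda>\<omega>. W \<omega> * g \<omega>)"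
    unfolding h_def using G.real_cond_exp_intg[OF intWg W(1) gM] by auto
  have int: "integrable M (\<lambda>\<omega>. \<bar>h \<omega> - expectation g\<bar>)"
    using inth by auto
  have "expectation (\<lambda>\<omega>. W \<omega> * g \<omega>) - expectation W * expectation g
      = expectation (\<lambda>\<omega>. W \<omega> * (h \<omega> - expectation g))"
    using intWh intW by (simp add: eq right_diff_distrib)
  also have "\<bar>\<dots>\<bar> \<le> expectation (\<lambda>\<omega>. \<bar>W \<omega> * (h \<omega> - expectation g)\<bar>)"
    by (rule integral_abs_bound)
  also have "\<dots> \<le> expectation (\<lambda>\<omega>. D * \<bar>h \<omega> - expectation g\<bar>)"
    using int W(2) D0 by (intro integral_mono') (auto simp: abs_mult intro!: mult_right_mono)
  also have "\<dots> = D * expectation (\<lambda>\<omega>. \<bar>h \<omega> - expectation g\<bar>)"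
    by simp
  also have "expectation (\<lambda>\<omega>. \<bar>h \<omega> - expectation g\<bar>) \<le> C / sqrt (real n)"
  proof -
    have "ennreal (expectation (\<lambda>\<omega>. \<bar>h \<omega> - expectation g\<bar>)) = (\<integral>\<^sup>+\<omega>. ennreal \<bar>h \<omega> - expectation g\<bar> \<partial>M)"
      using int by (intro nn_integral_eq_integral[symmetric]) auto
    also have "\<dots> \<le> ennreal (C / sqrt (real n))"
      unfolding h_def using n g by (rule mixing)
    finally show ?thesis
      using C_nonneg by (subst (asm) ennreal_le_iff) auto
  qed
  finally show ?thesis
    using D0 by (simp add: mult_left_mono)
qed

text \<open>A quantitative form of "depends on the process up to time \<open>k\<close>". The
  observables need not be measurable for any \<open>\<F> 0 k\<close>, only approximable at the rate
  of \<open>V_dist\<close>. The approximants obey the same bound \<open>D\<close>, which makes the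
  notion stable under products.\<close>

definition past :: "nat \<Rightarrow> real \<Rightarrow> real \<Rightarrow> ('w \<Rightarrow> real) \<Rightarrow> bool" where
  "past k D \<Lambda> W \<longleftrightarrow> W \<in> borel_measurable M \<and> 0 \<le> D \<and> 0 \<le> \<Lambda> \<and> (\<forall>\<omega>. \<bar>W \<omega>\<bar> \<le> D) \<and>
     (\<forall>r\<ge>1. \<exists>W' \<in> borel_measurable (\<F> 0 (enat (k + r))).
        (\<forall>\<omega>. \<bar>W' \<omega>\<bar> \<le> D) \<and> expectation (\<lambda>\<omega>. \<bar>W \<omega> - W' \<omega>\<bar>) \<le> \<Lambda> / sqrt (real r))"

lemma pastD:
  assumes "past k D \<Lambda> W"
  shows "W \<in> borel_measurable M" "0 \<le> D" "0 \<le> \<Lambda>" "\<bar>W \<omega>\<bar> \<le> D" "integrable M W"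
  using assms integrable_bounded[of W D] unfolding past_def by blast+

lemma pastE:
  assumes "past k D \<Lambda> W" "1 \<le> r"
  obtains W' where "W' \<in> borel_measurable (\<F> 0 (enat (k + r)))" "W' \<in> borel_measurable M"
    "\<And>\<omega>. \<bar>W' \<omega>\<bar> \<le> D" "integrable M W'" "expectation (\<lambda>\<omega>. \<bar>W \<omega> - W' \<omega>\<bar>) \<le> \<Lambda> / sqrt (real r)"
proof -
  obtain W' where *: "W' \<in> borel_measurable (\<F> 0 (enat (k + r)))" "\<And>\<omega>. \<bar>W' \<omega>\<bar> \<le> D"
    "expectation (\<lambda>\<omega>. \<bar>W \<omega> - W' \<omega>\<bar>) \<le> \<Lambda> / sqrt (real r)"
    using assms unfolding past_def by blast
  have "W' \<in> borel_measurable M"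
    using *(1) by (rule F_measurable) simp
  then show thesis
    using that * integrable_bounded[of W' D] by blast
qed

lemma past_mono:
  assumes "past k D \<Lambda> W" "k \<le> k'"
  shows "past k' D \<Lambda> W"
proof -
  have "W' \<in> borel_measurable (\<F> 0 (enat (k' + r)))" if "W' \<in> borel_measurable (\<F> 0 (enat (k + r)))"
    for W' :: "'w \<Rightarrow> real" and r
    using that assms(2) by (intro F_measurable_mono[OF that]) auto
  then show ?thesis
    using assms(1) unfolding past_def by blast
qed

lemma past_const: "past k \<bar>c\<bar> 0 (\<lambda>_. c)"
  unfolding past_def by (intro conjI allI impI bexI[where x="\<lambda>_. c"]) auto

text \<open>The product of the approximants approximates the product, with an error given by a
  Leibniz rule.\<close>

lemma past_mult:
  assumes W1: "past k D1 \<Lambda>1 W1" and W2: "past k D2 \<Lambda>2 W2"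
  shows "past k (D1 * D2) (D1 * \<Lambda>2 + D2 * \<Lambda>1) (\<lambda>\<omega>. W1 \<omega> * W2 \<omega>)"
  unfolding past_def
proof (intro conjI allI impI)
  note D1 = pastD[OF W1] and D2 = pastD[OF W2]
  show "(\<lambda>\<omega>. W1 \<omega> * W2 \<omega>) \<in> borel_measurable M" "0 \<le> D1 * D2" "0 \<le> D1 * \<Lambda>2 + D2 * \<Lambda>1"
    using D1 D2 by auto
  show "\<bar>W1 \<omega> * W2 \<omega>\<bar> \<le> D1 * D2" for \<omega>
    unfolding abs_mult using D1(2,4) D2(2,4) by (intro mult_mono) auto
  fix r :: nat
  assume r: "1 \<le> r"
  obtain W1' where W1': "W1' \<in> borel_measurable (\<F> 0 (enat (k + r)))" "W1' \<in> borel_measurable M"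
    "\<And>\<omega>. \<bar>W1' \<omega>\<bar> \<le> D1" "integrable M W1'" "expectation (\<lambda>\<omega>. \<bar>W1 \<omega> - W1' \<omega>\<bar>) \<le> \<Lambda>1 / sqrt (real r)"
    using pastE[OF W1 r] by blast
  obtain W2' where W2': "W2' \<in> borel_measurable (\<F> 0 (enat (k + r)))" "W2' \<in> borel_measurable M"
    "\<And>\<omega>. \<bar>W2' \<omega>\<bar> \<le> D2" "integrable M W2'" "expectation (\<lambda>\<omega>. \<bar>W2 \<omega> - W2' \<omega>\<bar>) \<le> \<Lambda>2 / sqrt (real r)"
    using pastE[OF W2 r] by blast
  show "\<exists>W'\<in>borel_measurable (\<F> 0 (enat (k + r))). (\<forall>\<omega>. \<bar>W' \<omega>\<bar> \<le> D1 * D2) \<and>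
      expectation (\<lambda>\<omega>. \<bar>W1 \<omega> * W2 \<omega> - W' \<omega>\<bar>) \<le> (D1 * \<Lambda>2 + D2 * \<Lambda>1) / sqrt (real r)"
  proof (intro bexI conjI allI)
    show "(\<lambda>\<omega>. W1' \<omega> * W2' \<omega>) \<in> borel_measurable (\<F> 0 (enat (k + r)))"
      using W1'(1) W2'(1) by simp
    show "\<bar>W1' \<omega> * W2' \<omega>\<bar> \<le> D1 * D2" for \<omega>
      unfolding abs_mult using W1'(3) W2'(3) D1(2) by (intro mult_mono) auto
    have "expectation (\<lambda>\<omega>. \<bar>W1 \<omega> * W2 \<omega> - W1' \<omega> * W2' \<omega>\<bar>)
        \<le> expectation (\<lambda>\<omega>. D1 * \<bar>W2 \<omega> - W2' \<omega>\<bar> + D2 * \<bar>W1 \<omega> - W1' \<omega>\<bar>)"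
      using abs_mult_diff_le D1 D2 W1'(3,4) W2'(3,4)
      by (intro integral_mono') (auto intro!: add_nonneg_nonneg)
    also have "\<dots> = D1 * expectation (\<lambda>\<omega>. \<bar>W2 \<omega> - W2' \<omega>\<bar>) + D2 * expectation (\<lambda>\<omega>. \<bar>W1 \<omega> - W1' \<omega>\<bar>)"
      using D1(5) D2(5) W1'(4) W2'(4) by simp
    also have "\<dots> \<le> D1 * (\<Lambda>2 / sqrt (real r)) + D2 * (\<Lambda>1 / sqrt (real r))"
      using W1'(5) W2'(5) D1(2) D2(2) by (intro add_mono mult_left_mono) auto
    finally show "expectation (\<lambda>\<omega>. \<bar>W1 \<omega> * W2 \<omega> - W1' \<omega> * W2' \<omega>\<bar>) \<le> (D1 * \<Lambda>2 + D2 * \<Lambda>1) / sqrt (real r)"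
      by (simp add: add_divide_distrib)
  qed
qed

lemma expectation_lipschitz_approx:
  assumes f: "bdd_lipschitz B L f" and r: "1 \<le> r"
  shows "expectation (\<lambda>\<omega>. \<bar>f (X s \<omega>) - f (V s r \<omega>)\<bar>) \<le> L * C / sqrt (real r)"
proof -
  note D = bdd_lipschitzD[OF f]
  note [measurable] = bdd_lipschitz_measurable[OF f] V_measurable[OF r]
  have "\<bar>f x - f y\<bar> \<le> B + B" for x y
    using D(1)[of x] D(1)[of y] by linarith
  then have "integrable M (\<lambda>\<omega>. \<bar>f (X s \<omega>) - f (V s r \<omega>)\<bar>)"
    by (intro integrable_bounded[where B="B + B"]) auto
  then have "ennreal (expectation (\<lambda>\<omega>. \<bar>f (X s \<omega>) - f (V s r \<omega>)\<bar>))
      = (\<integral>\<^sup>+\<omega>. ennreal \<bar>f (X s \<omega>) - f (V s r \<omega>)\<bar> \<partial>M)"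
    by (intro nn_integral_eq_integral[symmetric]) auto
  also have "\<dots> \<le> (\<integral>\<^sup>+\<omega>. ennreal L * ennreal (norm (X s \<omega> - V s r \<omega>)) \<partial>M)"
    using D by (intro nn_integral_mono) (simp flip: ennreal_mult')
  also have "\<dots> = ennreal L * (\<integral>\<^sup>+\<omega>. ennreal (norm (X s \<omega> - V s r \<omega>)) \<partial>M)"
    by (intro nn_integral_cmult) auto
  also have "\<dots> \<le> ennreal L * ennreal (C / sqrt (real r))"
    by (intro mult_left_mono V_dist r) auto
  also have "\<dots> = ennreal (L * C / sqrt (real r))"
    using D(4) by (simp flip: ennreal_mult')
  finally show ?thesis
    using C_nonneg D(4) by (subst (asm) ennreal_le_iff) auto
qed

text \<open>The approximant is \<open>f (V s r)\<close>; its algebra, with window from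
  \<open>s - r\<close> to \<open>s + r\<close>, is enlarged so as to start at time 0.\<close>

lemma past_observable:
  assumes f: "bdd_lipschitz B L f"
  shows "past s B (L * C) (\<lambda>\<omega>. f (X s \<omega>))"
  unfolding past_def
proof (intro conjI allI impI)
  note D = bdd_lipschitzD[OF f]
  note [measurable] = bdd_lipschitz_measurable[OF f]
  show "(\<lambda>\<omega>. f (X s \<omega>)) \<in> borel_measurable M"
    by measurable
  show "0 \<le> B" "0 \<le> L * C" "\<bar>f (X s \<omega>)\<bar> \<le> B" for \<omega>
    using D C_nonneg by auto
  fix r :: nat
  assume r: "1 \<le> r"
  show "\<exists>W'\<in>borel_measurable (\<F> 0 (enat (s + r))).
      (\<forall>\<omega>. \<bar>W' \<omega>\<bar> \<le> B) \<and> expectation (\<lambda>\<omega>. \<bar>f (X s \<omega>) - W' \<omega>\<bar>) \<le> L * C / sqrt (real r)"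
  proof (intro bexI conjI allI)
    show "(\<lambda>\<omega>. f (V s r \<omega>)) \<in> borel_measurable (\<F> 0 (enat (s + r)))"
      by (rule F_measurable_mono[where k="enat (s - r)" and l="enat (s + r)"])
        (use measurable_compose[OF V_meas[OF r] bdd_lipschitz_measurable[OF f]] in auto)
  qed (use D expectation_lipschitz_approx[OF f r] in auto)
qed

text \<open>Both factors are replaced by their approximations within distance \<open>r\<close> in time, which still
  leaves a gap of length at least \<open>r\<close> for the mixing condition.\<close>

lemma decoupling:
  assumes W: "past k D \<Lambda> W" and f: "bdd_lipschitz 1 L f" and r: "1 \<le> r" and s: "k + 3 * r \<le> s"
  shows "\<bar>expectation (\<lambda>\<omega>. W \<omega> * f (X s \<omega>)) - expectation W * expectation (\<lambda>\<omega>. f (X s \<omega>))\<bar>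
    \<le> (2 * D * L * C + 2 * \<Lambda> + D * C) / sqrt (real r)"
proof -
  obtain W' where W': "W' \<in> borel_measurable (\<F> 0 (enat (k + r)))" "W' \<in> borel_measurable M"
    "\<And>\<omega>. \<bar>W' \<omega>\<bar> \<le> D" "integrable M W'" "expectation (\<lambda>\<omega>. \<bar>W \<omega> - W' \<omega>\<bar>) \<le> \<Lambda> / sqrt (real r)"
    using pastE[OF W r] by blast
  note D = pastD[OF W] and fD = bdd_lipschitzD[OF f]
  note [measurable] = bdd_lipschitz_measurable[OF f] V_measurable[OF r] W'(2) D(1)
  define f0 f1 where "f0 = (\<lambda>\<omega>. f (X s \<omega>))" and "f1 = (\<lambda>\<omega>. f (V s r \<omega>))"
  have f0m[measurable]: "f0 \<in> borel_measurable M" and f1m[measurable]: "f1 \<in> borel_measurable M"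
    unfolding f0_def f1_def by measurable
  have b: "\<bar>f0 \<omega>\<bar> \<le> 1" "\<bar>f1 \<omega>\<bar> \<le> 1" for \<omega>
    using fD(1) by (auto simp: f0_def f1_def)
  have int: "integrable M f0" "integrable M f1"
    using integrable_bounded[OF f0m b(1)] integrable_bounded[OF f1m b(2)] .
  have b2: "\<bar>W \<omega> * f0 \<omega>\<bar> \<le> D * 1" "\<bar>W' \<omega> * f1 \<omega>\<bar> \<le> D * 1" for \<omega>
    unfolding abs_mult using b D(2,4) W'(3) by (intro mult_mono; simp)+
  have int2: "integrable M (\<lambda>\<omega>. W \<omega> * f0 \<omega>)" "integrable M (\<lambda>\<omega>. W' \<omega> * f1 \<omega>)"
    by (rule integrable_bounded[OF _ b2(1)], measurable, rule integrable_bounded[OF _ b2(2)], measurable)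
  have d: "expectation (\<lambda>\<omega>. \<bar>f0 \<omega> - f1 \<omega>\<bar>) \<le> L * C / sqrt (real r)"
    unfolding f0_def f1_def using f r by (rule expectation_lipschitz_approx)
  \<comment> \<open>One approximant is determined by time \<open>k + r\<close>, the other by the
    times from \<open>s - r\<close> on. Of the three lengths \<open>r\<close> between
    \<open>k\<close> and \<open>s\<close> at least one remains as the gap \<open>n\<close>.\<close>
  define n where "n = s - r - (k + r)"
  have n: "r \<le> n" "k + r + n = s - r"
    using s r by (auto simp: n_def)
  have mixed: "\<bar>expectation (\<lambda>\<omega>. W' \<omega> * f1 \<omega>) - expectation W' * expectation f1\<bar> \<le> D * C / sqrt (real r)"
  proof -
    have "f1 \<in> borel_measurable (\<F> (enat (s - r)) \<infinity>)"
      unfolding f1_def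
      by (rule F_measurable_mono[where k="enat (s - r)" and l="enat (s + r)"])
        (use measurable_compose[OF V_meas[OF r] bdd_lipschitz_measurable[OF f]] in auto)
    then have "\<bar>expectation (\<lambda>\<omega>. W' \<omega> * f1 \<omega>) - expectation W' * expectation f1\<bar> \<le> D * C / sqrt (real n)"
      using n r W' b by (intro mixing_covariance[where k="k + r"]) auto
    also have "\<dots> \<le> D * C / sqrt (real r)"
      using n r D(2) C_nonneg by (intro divide_left_mono) auto
    finally show ?thesis .
  qed
  have err1: "\<bar>expectation (\<lambda>\<omega>. W \<omega> * f0 \<omega>) - expectation (\<lambda>\<omega>. W' \<omega> * f1 \<omega>)\<bar>
      \<le> D * (L * C / sqrt (real r)) + \<Lambda> / sqrt (real r)"
  proof -
    have "\<bar>expectation (\<lambda>\<omega>. W \<omega> * f0 \<omega>) - expectation (\<lambda>\<omega>. W' \<omega> * f1 \<omega>)\<bar>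
        = \<bar>expectation (\<lambda>\<omega>. W \<omega> * f0 \<omega> - W' \<omega> * f1 \<omega>)\<bar>"
      using int2 by simp
    also have "\<dots> \<le> expectation (\<lambda>\<omega>. \<bar>W \<omega> * f0 \<omega> - W' \<omega> * f1 \<omega>\<bar>)"
      by (rule integral_abs_bound)
    also have "\<dots> \<le> expectation (\<lambda>\<omega>. D * \<bar>f0 \<omega> - f1 \<omega>\<bar> + 1 * \<bar>W \<omega> - W' \<omega>\<bar>)"
      using D W'(4) int b by (intro integral_mono' abs_mult_diff_le) auto
    also have "\<dots> = D * expectation (\<lambda>\<omega>. \<bar>f0 \<omega> - f1 \<omega>\<bar>) + expectation (\<lambda>\<omega>. \<bar>W \<omega> - W' \<omega>\<bar>)"
      using D(5) W'(4) int by simp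
    also have "\<dots> \<le> D * (L * C / sqrt (real r)) + \<Lambda> / sqrt (real r)"
      using d W'(5) D(2) by (intro add_mono mult_left_mono) auto
    finally show ?thesis .
  qed
  have err2: "\<bar>expectation W * expectation f0 - expectation W' * expectation f1\<bar>
      \<le> D * (L * C / sqrt (real r)) + 1 * (\<Lambda> / sqrt (real r))"
  proof -
    have "\<bar>expectation W\<bar> \<le> D" "\<bar>expectation f1\<bar> \<le> 1"
      using D(2,4,5) int b by (auto simp: abs_le_iff minus_le_iff intro!: integral_le_const integral_ge_const AE_I2)
    then have "\<bar>expectation W * expectation f0 - expectation W' * expectation f1\<bar>
      \<le> D * \<bar>expectation f0 - expectation f1\<bar> + 1 * \<bar>expectation W - expectation W'\<bar>"
      by (rule abs_mult_diff_le)
    also have "\<bar>expectation f0 - expectation f1\<bar> \<le> L * C / sqrt (real r)"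
      using int integral_abs_bound[of M "\<lambda>\<omega>. f0 \<omega> - f1 \<omega>"] d by simp
    also have "\<bar>expectation W - expectation W'\<bar> \<le> \<Lambda> / sqrt (real r)"
      using D(5) W'(4,5) integral_abs_bound[of M "\<lambda>\<omega>. W \<omega> - W' \<omega>"] by simp
    finally show ?thesis
      using D(2) by (simp add: mult_left_mono)
  qed
  \<comment> \<open>The approximation error enters twice, in the expectation of the product and in
    the product of expectations, and the mixing error once. This explains the factors 2 in the
    constant.\<close>
  have triangle: "\<bar>x - y\<bar> \<le> e1 + e2 + e" if "\<bar>x' - y'\<bar> \<le> e" "\<bar>x - x'\<bar> \<le> e1" "\<bar>y - y'\<bar> \<le> e2"
    for x y x' y' e e1 e2 :: real
    using that by linarith
  have "\<bar>expectation (\<lambda>\<omega>. W \<omega> * f0 \<omega>) - expectation W * expectation f0\<bar>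
      \<le> (D * (L * C / sqrt (real r)) + \<Lambda> / sqrt (real r)) + (D * (L * C / sqrt (real r)) + 1 * (\<Lambda> / sqrt (real r)))
        + D * C / sqrt (real r)"
    using triangle[OF mixed err1 err2] .
  also have "\<dots> = (2 * D * L * C + 2 * \<Lambda> + D * C) / sqrt (real r)"
    by (simp add: add_divide_distrib algebra_simps)
  finally show ?thesis
    by (simp add: f0_def)
qed

end

text \<open>\<open>s m\<close> is later, by \<open>\<epsilon> (m - n)\<close>, than every other time that occurs in \<open>Z n * Z m\<close>, where \<open>n < m\<close>
  and \<open>Z n\<close> involves the times up to \<open>k n\<close> and the time \<open>s n\<close>.\<close>

definition separated :: "real \<Rightarrow> (nat \<Rightarrow> nat) \<Rightarrow> (nat \<Rightarrow> nat) \<Rightarrow> bool" where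
  "separated \<epsilon> k s \<longleftrightarrow> (\<forall>n\<ge>1. k n \<le> s n) \<and>
     (\<forall>n\<ge>1. \<forall>m>n. real (k m) + \<epsilon> * real (m - n) \<le> real (s m) \<and> real (s n) + \<epsilon> * real (m - n) \<le> real (s m))"

section \<open>Second moments and strong laws along separated times\<close>

context weakly_dependent_process
begin

text \<open>All factors except the latest, \<open>f (X (s m))\<close>, are collected into one
  variable that belongs to the past of an earlier time. Decoupling then leaves the mean of
  \<open>f\<close>, which is 0. \<open>B\<close> and \<open>\<Gamma>\<close> are the constants that
  \<open>past_mult\<close> yields for the collected factors.\<close>

lemma covariance_bound:
  assumes eps: "0 < \<epsilon>" and U: "\<And>n. 1 \<le> n \<Longrightarrow> past (k n) D \<Lambda> (U n)"
    and f: "bdd_lipschitz 1 L f" and f0: "(\<integral>x. f x \<partial>\<mu>) = 0"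
    and sep: "separated \<epsilon> k s" and nm: "1 \<le> n" "n < m"
  defines "B \<equiv> D * D" and "\<Gamma> \<equiv> D * D * (L * C) + (D * \<Lambda> + D * \<Lambda>)"
  shows "\<bar>expectation (\<lambda>\<omega>. (U n \<omega> * f (X (s n) \<omega>)) * (U m \<omega> * f (X (s m) \<omega>)))\<bar>
    \<le> (2 * B * L * C + 2 * \<Gamma> + B * C + B) * sqrt (6 / \<epsilon>) / sqrt (real (m - n))"
proof -
  \<comment> \<open>The latest time other than \<open>s m\<close>; it also dominates
    \<open>k n\<close>, since \<open>k n \<le> s n\<close>.\<close>
  define j where "j = max (s n) (k m)"
  have gap: "real j + \<epsilon> * real (m - n) \<le> real (s m)"
    using sep nm unfolding separated_def j_def by (cases "s n \<le> k m") (simp_all add: max_def)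
  have "k n \<le> j" "k m \<le> j" "s n \<le> j"
    using sep nm by (auto simp: separated_def j_def max_def intro: order_trans)
  then have pn: "past j D \<Lambda> (U n)" and pm: "past j D \<Lambda> (U m)" and pf: "past j 1 (L * C) (\<lambda>\<omega>. f (X (s n) \<omega>))"
    using nm past_mono[OF U] past_mono[OF past_observable[OF f]] by auto
  then have W: "past j B \<Gamma> (\<lambda>\<omega>. (U n \<omega> * U m \<omega>) * f (X (s n) \<omega>))" (is "past _ _ _ ?W")
    using past_mult[OF past_mult[OF pn pm] pf] by (simp add: B_def \<Gamma>_def)
  note WD = pastD[OF W] and fD = bdd_lipschitzD[OF f]
  have ex0: "expectation (\<lambda>\<omega>. f (X (s m) \<omega>)) = 0"
    using f0 expectation_eq[OF bdd_lipschitz_measurable[OF f]] by simp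
  have comm: "(\<lambda>\<omega>. (U n \<omega> * f (X (s n) \<omega>)) * (U m \<omega> * f (X (s m) \<omega>))) = (\<lambda>\<omega>. ?W \<omega> * f (X (s m) \<omega>))"
    by (simp add: ac_simps)
  define \<delta> where "\<delta> = \<epsilon> * real (m - n)"
  have \<delta>: "0 < \<delta>"
    using eps nm by (simp add: \<delta>_def)
  \<comment> \<open>The largest integer for which three lengths \<open>r\<close> fit into the
    guaranteed gap \<open>\<delta>\<close>, as \<open>decoupling\<close> requires.\<close>
  define r where "r = nat \<lfloor>\<delta> / 3\<rfloor>"
  define A where "A = 2 * B * L * C + 2 * \<Gamma> + B * C"
  have A0: "0 \<le> A"
    using WD(2,3) fD(4) C_nonneg by (simp add: A_def)
  have s6: "sqrt (6 / \<epsilon>) / sqrt (real (m - n)) = sqrt (6 / \<delta>)"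
    by (simp add: \<delta>_def flip: real_sqrt_divide)
  have "\<bar>expectation (\<lambda>\<omega>. ?W \<omega> * f (X (s m) \<omega>))\<bar> \<le> (A + B) * sqrt (6 / \<delta>)"
  \<comment> \<open>For \<open>r = 0\<close> the gap is below 3, so
    \<open>sqrt (6 / \<delta>)\<close> is at least 1 and the trivial bound \<open>B\<close>
    suffices. This is the origin of the last summand \<open>B\<close> in the constant.\<close>
  proof (cases "r = 0")
    case True
    then have "\<lfloor>\<delta> / 3\<rfloor> \<le> 0"
      by (simp add: r_def del: floor_divide_eq_div_numeral)
    then have "\<delta> < 3"
      by linarith
    then have one: "1 \<le> sqrt (6 / \<delta>)"
      using \<delta> by simp
    have "\<bar>?W \<omega> * f (X (s m) \<omega>)\<bar> \<le> B * 1" for \<omega>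
      unfolding abs_mult[of "?W \<omega>"] using WD(2,4) fD(1) by (intro mult_mono) auto
    then have "expectation (\<lambda>\<omega>. \<bar>?W \<omega> * f (X (s m) \<omega>)\<bar>) \<le> B * 1"
      using WD(1) bdd_lipschitz_measurable[OF f]
      by (intro integral_le_const AE_I2 integrable_abs integrable_bounded[where B="B * 1"] borel_measurable_times) auto
    then have "\<bar>expectation (\<lambda>\<omega>. ?W \<omega> * f (X (s m) \<omega>))\<bar> \<le> B * 1"
      by (rule order_trans[OF integral_abs_bound])
    also have "\<dots> \<le> (A + B) * sqrt (6 / \<delta>)"
      using one A0 WD(2) by (intro mult_mono) auto
    finally show ?thesis .
  next
    case False
    have le: "real r \<le> \<delta> / 3" and ge: "\<delta> / 3 < real r + 1"
    proof -
      have "real r = of_int \<lfloor>\<delta> / 3\<rfloor>"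
        using \<delta> by (simp add: r_def)
      then show "real r \<le> \<delta> / 3" "\<delta> / 3 < real r + 1"
        by linarith+
    qed
    have "real j + 3 * real r \<le> real (s m)"
      using gap le by (simp add: \<delta>_def)
    then have "j + 3 * r \<le> s m"
      by linarith
    then have "\<bar>expectation (\<lambda>\<omega>. ?W \<omega> * f (X (s m) \<omega>))\<bar> \<le> A / sqrt (real r)"
      using decoupling[OF W f, of r "s m"] False by (simp add: ex0 A_def)
    also have "\<dots> = A * sqrt (1 / real r)"
      by (simp add: real_sqrt_divide)
    also have "\<dots> \<le> (A + B) * sqrt (6 / \<delta>)"
    proof (intro mult_mono)
      \<comment> \<open>From \<open>\<delta> / 3 < r + 1 \<le> 2 * r\<close>; hence the 6 under the
        square root.\<close>
      have "\<delta> \<le> 6 * real r"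
        using ge False by linarith
      then show "sqrt (1 / real r) \<le> sqrt (6 / \<delta>)"
        using \<delta> False by (simp add: field_simps)
    qed (use A0 WD(2) in auto)
    finally show ?thesis .
  qed
  then show ?thesis
    unfolding comm times_divide_eq_right[symmetric] s6 A_def .
qed

text \<open>The point is uniformity: \<open>A\<close> is chosen before \<open>U\<close>,
  \<open>f\<close>, \<open>s\<close>, \<open>k\<close> and \<open>N\<close>. In
  \<open>average_powers_bounded\<close> it is applied to a whole sequence of functions
  \<open>f\<close>.\<close>

lemma second_moment_bound:
  assumes eps: "0 < \<epsilon>" and nn: "0 \<le> D" "0 \<le> \<Lambda>" "0 \<le> L"
  obtains A where "\<And>U f s k N. (\<And>n. 1 \<le> n \<Longrightarrow> past (k n) D \<Lambda> (U n)) \<Longrightarrow> bdd_lipschitz 1 L f \<Longrightarrow>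
    (\<integral>x. f x \<partial>\<mu>) = 0 \<Longrightarrow> separated \<epsilon> k s \<Longrightarrow>
    expectation (\<lambda>\<omega>. (\<Sum>n=1..N. U n \<omega> * f (X (s n) \<omega>))\<^sup>2) \<le> A * (real N * sqrt (real N))"
proof -
  define B where "B = D * D"
  define \<Gamma> where "\<Gamma> = D * D * (L * C) + (D * \<Lambda> + D * \<Lambda>)"
  define A where "A = (2 * B * L * C + 2 * \<Gamma> + B * C + B) * sqrt (6 / \<epsilon>)"
  have A: "0 \<le> A"
    using nn eps C_nonneg by (simp add: A_def B_def \<Gamma>_def)
  show thesis
  proof (rule that[of "D\<^sup>2 + 4 * A"], rule second_moment_sum_le[OF _ _ _ A])
    fix U :: "nat \<Rightarrow> 'w \<Rightarrow> real" and f s k and n :: nat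
    assume U: "\<And>n. 1 \<le> n \<Longrightarrow> past (k n) D \<Lambda> (U n)" and f: "bdd_lipschitz 1 L f"
      and f0: "(\<integral>x. f x \<partial>\<mu>) = 0" and sep: "separated \<epsilon> k s" and n: "1 \<le> n"
    have Un: "past (k n) D \<Lambda> (U n)"
      using U n by blast
    show "(\<lambda>\<omega>. U n \<omega> * f (X (s n) \<omega>)) \<in> borel_measurable M"
      using pastD(1)[OF Un] bdd_lipschitz_measurable[OF f] by simp
    have "\<bar>U n \<omega> * f (X (s n) \<omega>)\<bar> \<le> D * 1" for \<omega>
      unfolding abs_mult using pastD(2,4)[OF Un] bdd_lipschitzD(1)[OF f] by (intro mult_mono) auto
    then show "\<bar>U n \<omega> * f (X (s n) \<omega>)\<bar> \<le> D" for \<omega>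
      by simp
    fix m
    assume "n < m"
    then show "\<bar>expectation (\<lambda>\<omega>. U n \<omega> * f (X (s n) \<omega>) * (U m \<omega> * f (X (s m) \<omega>)))\<bar> \<le> A / sqrt (real (m - n))"
      using covariance_bound[OF eps U f f0 sep n]
      by (simp add: A_def B_def \<Gamma>_def)
  qed
qed

lemma bdd_lipschitz_integral:
  assumes "bdd_lipschitz B L f"
  shows "\<bar>\<integral>x. f x \<partial>\<mu>\<bar> \<le> B" "integrable \<mu> f"
proof -
  interpret mu: prob_space \<mu>
    by (rule prob_space_mu)
  note D = bdd_lipschitzD[OF assms]
  have [measurable]: "f \<in> borel_measurable \<mu>"
    using bdd_lipschitz_measurable[OF assms] by simp
  show int: "integrable \<mu> f"
    using D by (intro mu.integrable_const_bound[where B=B]) auto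
  have "\<bar>\<integral>x. f x \<partial>\<mu>\<bar> \<le> (\<integral>x. \<bar>f x\<bar> \<partial>\<mu>)"
    by (rule integral_abs_bound)
  also have "\<dots> \<le> B"
    using D int by (intro mu.integral_le_const AE_I2 integrable_abs) auto
  finally show "\<bar>\<integral>x. f x \<partial>\<mu>\<bar> \<le> B" .
qed

text \<open>In an average of products, the latest factor may be replaced by its mean.\<close>

lemma slln_centered:
  assumes eps: "0 < \<epsilon>" and U: "\<And>n. 1 \<le> n \<Longrightarrow> past (k n) D \<Lambda> (U n)"
    and f: "bdd_lipschitz B L f" and sep: "separated \<epsilon> k s"
  shows "AE \<omega> in M. (\<lambda>N. 1 / real N * (\<Sum>n=1..N. U n \<omega> * (f (X (s n) \<omega>) - (\<integral>x. f x \<partial>\<mu>)))) \<longlonglongrightarrow> 0"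
proof -
  interpret mu: prob_space \<mu>
    by (rule prob_space_mu)
  define e where "e = (\<integral>x. f x \<partial>\<mu>)"
  \<comment> \<open>The centred function is bounded by \<open>2 * B\<close>, so division by
    \<open>c\<close> gives the bound 1; adding 1 keeps \<open>c\<close> positive even when
    \<open>B = 0\<close>.\<close>
  define c where "c = 2 * B + 1"
  define g where "g = (\<lambda>x. (f x - e) / c)"
  note fD = bdd_lipschitzD[OF f] and UD = pastD[OF U[OF order_refl]]
  have c: "0 < c"
    using fD(3) by (simp add: c_def)
  have g: "bdd_lipschitz 1 (L / c) g"
    unfolding bdd_lipschitz_def g_def
  proof (intro conjI allI)
    fix x y
    have "\<bar>f x - e\<bar> \<le> c"
      using fD(1)[of x] bdd_lipschitz_integral(1)[OF f] by (auto simp: c_def e_def)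
    then show "\<bar>(f x - e) / c\<bar> \<le> 1"
      using c by simp
    have "\<bar>(f x - e) / c - (f y - e) / c\<bar> = \<bar>f x - f y\<bar> / c"
      using c by (simp add: diff_divide_distrib[symmetric])
    then show "\<bar>(f x - e) / c - (f y - e) / c\<bar> \<le> L / c * norm (x - y)"
      using fD(2)[of x y] c by (simp add: divide_right_mono)
  qed (use c fD in auto)
  have g0: "(\<integral>x. g x \<partial>\<mu>) = 0"
    using bdd_lipschitz_integral(2)[OF f] by (simp add: g_def e_def mu.prob_space)
  obtain A where A: "\<And>N. expectation (\<lambda>\<omega>. (\<Sum>n=1..N. U n \<omega> * g (X (s n) \<omega>))\<^sup>2) \<le> A * (real N * sqrt (real N))"
  proof (rule second_moment_bound[OF eps UD(2,3) bdd_lipschitzD(4)[OF g]])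
    fix A
    assume *: "\<And>U f s k N. (\<And>n. 1 \<le> n \<Longrightarrow> past (k n) D \<Lambda> (U n)) \<Longrightarrow> bdd_lipschitz 1 (L / c) f \<Longrightarrow>
      (\<integral>x. f x \<partial>\<mu>) = 0 \<Longrightarrow> separated \<epsilon> k s \<Longrightarrow>
      expectation (\<lambda>\<omega>. (\<Sum>n=1..N. U n \<omega> * f (X (s n) \<omega>))\<^sup>2) \<le> A * (real N * sqrt (real N))"
    show thesis
      using that[of A] *[OF U g g0 sep] by simp
  qed
  have "AE \<omega> in M. (\<lambda>N. 1 / real N * (\<Sum>n=1..N. U n \<omega> * g (X (s n) \<omega>))) \<longlonglongrightarrow> 0"
  proof (rule slln_of_second_moment[OF _ _ A])
    fix n :: nat
    assume n: "1 \<le> n"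
    show "(\<lambda>\<omega>. U n \<omega> * g (X (s n) \<omega>)) \<in> borel_measurable M"
      using pastD(1)[OF U[OF n]] bdd_lipschitz_measurable[OF g] by simp
    show "\<bar>U n \<omega> * g (X (s n) \<omega>)\<bar> \<le> D * 1" for \<omega>
      unfolding abs_mult using pastD(2,4)[OF U[OF n]] bdd_lipschitzD(1)[OF g] by (intro mult_mono) auto
  qed
  then show ?thesis
  proof eventually_elim
    case (elim \<omega>)
    have "U n \<omega> * (f (X (s n) \<omega>) - e) = c * (U n \<omega> * g (X (s n) \<omega>))" for n
      using c by (simp add: g_def)
    then have "(\<lambda>N. 1 / real N * (\<Sum>n=1..N. U n \<omega> * (f (X (s n) \<omega>) - e)))
        = (\<lambda>N. c * (1 / real N * (\<Sum>n=1..N. U n \<omega> * g (X (s n) \<omega>))))"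
      by (simp add: sum_distrib_left algebra_simps)
    then show ?case
      using tendsto_mult_left[OF elim, of c] by (simp add: e_def)
  qed
qed

text \<open>Along \<open>N = 2\<^sup>k\<close> the function is truncated at \<open>T k = b\<^sup>k\<close>, with \<open>b > 1\<close> so small that the variance of the
  truncated averages is summable; what is cut off is controlled by the moment of order \<open>t + 1\<close>.
  The averages for other \<open>N\<close> are compared with the next power of \<open>2\<close>.\<close>

lemma average_powers_bounded:
  fixes t :: nat
  assumes eps: "0 < \<epsilon>" and sep: "separated \<epsilon> (\<lambda>_. 0) s" and t: "1 \<le> t"
    and moment: "integrable \<mu> (\<lambda>x. norm x ^ Suc t)"
  shows "AE \<omega> in M. \<exists>c. \<forall>N. 1 / real N * (\<Sum>n=1..N. norm (X (s n) \<omega>) ^ t) \<le> c"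
proof -
  interpret mu: prob_space \<mu>
    by (rule prob_space_mu)
  \<comment> \<open>Chosen so that \<open>2^k = (T k ^ t)^8\<close>: the truncated power is at most
    the eighth root of the number of summands.\<close>
  define b where "b = root (8 * t) 2"
  have b: "1 < b" "b ^ (8 * t) = 2"
    using t by (auto simp: b_def)
  define T where "T k = b ^ k" for k :: nat
  have T1: "1 \<le> T k" and T0: "0 < T k" for k
    using b(1) by (auto simp: T_def)
  have T8: "(T k ^ t) ^ 8 = 2 ^ k" for k
    unfolding b(2)[symmetric] by (simp add: T_def ac_simps flip: power_mult)
  \<comment> \<open>The truncated power scaled to the interval from 0 to 1; its Lipschitz constant
    is \<open>t\<close> for every \<open>k\<close> because \<open>1 \<le> T k\<close>.\<close>
  define g :: "nat \<Rightarrow> 'b \<Rightarrow> real" where "g k x = (min (norm x) (T k) / T k) ^ t" for k x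
  have g01: "0 \<le> g k x" "g k x \<le> 1" for k x
    using T0[of k] by (auto simp: g_def min_def intro!: power_le_one)
  have g_lip: "bdd_lipschitz 1 (real t) (g k)" for k
    unfolding bdd_lipschitz_def
  proof (intro conjI allI)
    fix x y :: 'b
    show "\<bar>g k x\<bar> \<le> 1"
      using g01[of k x] by simp
    let ?u = "min (norm x) (T k) / T k" and ?v = "min (norm y) (T k) / T k"
    have "\<bar>g k x - g k y\<bar> \<le> real t * \<bar>?u - ?v\<bar>"
      using norm_power_diff[of ?u ?v t] T0[of k] by (auto simp: g_def min_def)
    also have "\<bar>?u - ?v\<bar> = \<bar>min (norm x) (T k) - min (norm y) (T k)\<bar> / T k"
      using T0[of k] by (simp add: diff_divide_distrib[symmetric])
    also have "\<dots> \<le> \<bar>min (norm x) (T k) - min (norm y) (T k)\<bar>"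
      using T1[of k] T0[of k] by (simp add: divide_le_eq mult_le_cancel_left1)
    also have "\<dots> \<le> \<bar>norm x - norm y\<bar>"
      by (auto simp: min_def)
    also have "\<dots> \<le> norm (x - y)"
      by (rule norm_triangle_ineq3)
    finally show "\<bar>g k x - g k y\<bar> \<le> real t * norm (x - y)"
      by (simp add: mult_left_mono)
  qed auto
  define f where "f k x = g k x - (\<integral>x. g k x \<partial>\<mu>)" for k x
  have e01: "0 \<le> (\<integral>x. g k x \<partial>\<mu>)" "(\<integral>x. g k x \<partial>\<mu>) \<le> 1" for k
    using bdd_lipschitz_integral[OF g_lip[of k]] g01 by (auto intro!: integral_nonneg_AE)
  have f_lip: "bdd_lipschitz 1 (real t) (f k)" for k
    unfolding bdd_lipschitz_def
  proof (intro conjI allI)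
    fix x y :: 'b
    show "\<bar>f k x\<bar> \<le> 1"
      using g01[of k x] e01[of k] by (auto simp: f_def)
    show "\<bar>f k x - f k y\<bar> \<le> real t * norm (x - y)"
      using bdd_lipschitzD(2)[OF g_lip[of k]] by (simp add: f_def)
  qed auto
  have f0: "(\<integral>x. f k x \<partial>\<mu>) = 0" for k
    using bdd_lipschitz_integral(2)[OF g_lip[of k]] by (simp add: f_def mu.prob_space)
  have one: "past k 1 0 (\<lambda>_. 1)" for k
    using past_const[of k 1] by simp
  \<comment> \<open>The normalization by \<open>T k\<close> makes the constant independent of \<open>k\<close>.\<close>
  obtain A where A: "\<And>N k. expectation (\<lambda>\<omega>. (\<Sum>n=1..N. f k (X (s n) \<omega>))\<^sup>2) \<le> A * (real N * sqrt (real N))"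
  proof (rule second_moment_bound[OF eps, of 1 0 "real t"])
    fix A
    assume *: "\<And>U f s k N. (\<And>n. 1 \<le> n \<Longrightarrow> past (k n) 1 0 (U n)) \<Longrightarrow> bdd_lipschitz 1 (real t) f \<Longrightarrow>
      (\<integral>x. f x \<partial>\<mu>) = 0 \<Longrightarrow> separated \<epsilon> k s \<Longrightarrow>
      expectation (\<lambda>\<omega>. (\<Sum>n=1..N. U n \<omega> * f (X (s n) \<omega>))\<^sup>2) \<le> A * (real N * sqrt (real N))"
    show thesis
      using that[of A] *[of "\<lambda>_. 0" "\<lambda>_ _. 1", OF one f_lip f0 sep] by simp
  qed auto
  have A0: "0 \<le> A"
  proof -
    have "0 \<le> expectation (\<lambda>\<omega>. (\<Sum>n=1..1. f 0 (X (s n) \<omega>))\<^sup>2)"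
      by (intro integral_nonneg_AE) auto
    also have "\<dots> \<le> A * (real 1 * sqrt (real 1))"
      by (rule A)
    finally show ?thesis
      by simp
  qed
  have fm[measurable]: "f k \<in> borel_measurable borel" for k
    by (rule bdd_lipschitz_measurable[OF f_lip])
  \<comment> \<open>\<open>Y1\<close> is the square of the centred truncated average with the
    scaling undone, and \<open>Y2\<close> is the average of what the truncation removes.\<close>
  define Y1 where "Y1 k \<omega> = (T k ^ t / 2 ^ k * (\<Sum>n=1..2 ^ k. f k (X (s n) \<omega>)))\<^sup>2" for k \<omega>
  define Y2 where "Y2 k \<omega> = 1 / 2 ^ k * (\<Sum>n=1..2 ^ k. norm (X (s n) \<omega>) ^ t - min (norm (X (s n) \<omega>)) (T k) ^ t)" for k \<omega>
  define m1 where "m1 = (\<integral>x. norm x ^ Suc t \<partial>\<mu>)"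
  have m1: "0 \<le> m1"
    by (simp add: m1_def)
  have "AE \<omega> in M. (\<lambda>k. Y1 k \<omega>) \<longlonglongrightarrow> 0"
  proof (rule AE_tendsto_0_of_summable)
    fix k :: nat
    have int: "integrable M (\<lambda>\<omega>. (\<Sum>n=1..2 ^ k. f k (X (s n) \<omega>))\<^sup>2)"
    proof (rule integrable_bounded)
      have "\<bar>\<Sum>n=1..2 ^ k. f k (X (s n) \<omega>)\<bar> \<le> (\<Sum>n=1..(2::nat) ^ k. 1)" for \<omega>
        by (rule order_trans[OF sum_abs sum_mono]) (use bdd_lipschitzD(1)[OF f_lip] in auto)
      then show "\<bar>(\<Sum>n=1..2 ^ k. f k (X (s n) \<omega>))\<^sup>2\<bar> \<le> (\<Sum>n=1..(2::nat) ^ k. 1)\<^sup>2" for \<omega>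
        by (metis abs_ge_zero power_abs power_mono)
    qed simp
    have "(\<integral>\<^sup>+\<omega>. ennreal (Y1 k \<omega>) \<partial>M) = ennreal (expectation (\<lambda>\<omega>. (T k ^ t / 2 ^ k)\<^sup>2 * (\<Sum>n=1..2 ^ k. f k (X (s n) \<omega>))\<^sup>2))"
      unfolding Y1_def power_mult_distrib using int by (intro nn_integral_eq_integral) auto
    also have "\<dots> \<le> ennreal ((T k ^ t / 2 ^ k)\<^sup>2 * (A * (real (2 ^ k) * sqrt (real (2 ^ k)))))"
      unfolding integral_mult_right_zero by (intro ennreal_leI mult_left_mono A) auto
    also have "(T k ^ t / 2 ^ k)\<^sup>2 * (A * (real (2 ^ k) * sqrt (real (2 ^ k)))) = A * (1 / (b ^ t)\<^sup>2) ^ k"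
    proof -
      \<comment> \<open>In terms of \<open>u\<close> the bound is
        \<open>(u / u^8)^2 * A * u^8 * u^4 = A / u^2\<close>, a geometric sequence in
        \<open>k\<close>.\<close>
      define u where "u = T k ^ t"
      have u: "0 < u" "2 ^ k = u ^ 8" "(1 / (b ^ t)\<^sup>2) ^ k = 1 / u\<^sup>2"
        using b(1) T8[of k] by (auto simp: u_def T_def power_divide ac_simps simp flip: power_mult)
      have "sqrt (u ^ 8) = u ^ 4"
        by (rule real_sqrt_unique) (use u in \<open>auto simp flip: power_mult\<close>)
      then have "(u / u ^ 8)\<^sup>2 * (A * (u ^ 8 * sqrt (u ^ 8))) = A * (1 / u\<^sup>2)"
        using u(1) by (simp add: divide_simps eval_nat_numeral)
      then show ?thesis
        by (simp add: u(2,3) flip: u_def)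
    qed
    finally show "(\<integral>\<^sup>+\<omega>. ennreal (Y1 k \<omega>) \<partial>M) \<le> ennreal (A * (1 / (b ^ t)\<^sup>2) ^ k)" .
    have "1 < (b ^ t)\<^sup>2"
      using b(1) t by (intro one_less_power) auto
    then show "summable (\<lambda>k. A * (1 / (b ^ t)\<^sup>2) ^ k)"
      by (intro summable_mult summable_geometric) (auto simp: divide_less_eq)
  qed (use A0 in \<open>auto simp: Y1_def\<close>)
  moreover have "AE \<omega> in M. (\<lambda>k. Y2 k \<omega>) \<longlonglongrightarrow> 0"
  proof (rule AE_tendsto_0_of_summable)
    fix k :: nat
    \<comment> \<open>The difference vanishes unless \<open>norm x\<close> exceeds
      \<open>T k\<close>, and then one more power of \<open>norm x\<close> pays for the factor
      \<open>1 / T k\<close>.\<close>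
    have pt: "norm x ^ t - min (norm x) (T k) ^ t \<le> 1 / T k * norm x ^ Suc t" for x :: 'b
    proof (cases "norm x \<le> T k")
      case True
      then show ?thesis
        using T0[of k] by (simp add: min_def)
    next
      case False
      then have "norm x ^ t * T k \<le> norm x ^ t * norm x"
        by (intro mult_left_mono) auto
      then have "norm x ^ t \<le> 1 / T k * norm x ^ Suc t"
        using T0[of k] by (simp add: field_simps)
      then show ?thesis
        using T0[of k] False by (smt (verit) min_def zero_le_power)
    qed
    have nnr: "0 \<le> norm x ^ t - min (norm x) (T k) ^ t" for x :: 'b
      using T0[of k] by (auto simp: min_def intro!: power_mono)
    show "Y2 k \<omega> \<ge> 0" for \<omega>
      unfolding Y2_def using nnr by (intro mult_nonneg_nonneg sum_nonneg) auto
    have int: "integrable M (\<lambda>\<omega>. norm (X n \<omega>) ^ Suc t)" and ex: "expectation (\<lambda>\<omega>. norm (X n \<omega>) ^ Suc t) = m1" for n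
    proof -
      show "integrable M (\<lambda>\<omega>. norm (X n \<omega>) ^ Suc t)"
        using moment unfolding X_distr[of n, symmetric] by (subst (asm) integrable_distr_eq) auto
      show "expectation (\<lambda>\<omega>. norm (X n \<omega>) ^ Suc t) = m1"
        unfolding m1_def by (rule expectation_eq) simp
    qed
    have "(\<integral>\<^sup>+\<omega>. ennreal (Y2 k \<omega>) \<partial>M) \<le> (\<integral>\<^sup>+\<omega>. ennreal (1 / 2 ^ k * (\<Sum>n=1..2 ^ k. 1 / T k * norm (X (s n) \<omega>) ^ Suc t)) \<partial>M)"
      unfolding Y2_def by (intro nn_integral_mono ennreal_leI mult_left_mono sum_mono pt) auto
    also have "\<dots> = ennreal (expectation (\<lambda>\<omega>. 1 / 2 ^ k * (\<Sum>n=1..2 ^ k. 1 / T k * norm (X (s n) \<omega>) ^ Suc t)))"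
    proof (intro nn_integral_eq_integral integrable_mult_right Bochner_Integration.integrable_sum AE_I2 mult_nonneg_nonneg sum_nonneg)
      show "integrable M (\<lambda>\<omega>. norm (X (s n) \<omega>) ^ Suc t)" for n
        by (rule int)
    qed (use T0[of k] in auto)
    also have "expectation (\<lambda>\<omega>. 1 / 2 ^ k * (\<Sum>n=1..2 ^ k. 1 / T k * norm (X (s n) \<omega>) ^ Suc t))
        = 1 / 2 ^ k * (\<Sum>n=1..(2::nat) ^ k. 1 / T k * m1)"
      by (simp add: int ex del: power_Suc)
    also have "\<dots> = m1 * (1 / b) ^ k"
      by (simp add: T_def power_divide)
    finally show "(\<integral>\<^sup>+\<omega>. ennreal (Y2 k \<omega>) \<partial>M) \<le> ennreal (m1 * (1 / b) ^ k)" .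
    show "summable (\<lambda>k. m1 * (1 / b) ^ k)"
      using b(1) by (intro summable_mult summable_geometric) (auto simp: divide_less_eq)
  qed (use m1 b(1) in \<open>auto simp: Y2_def\<close>)
  ultimately show ?thesis
  proof eventually_elim
    case (elim \<omega>)
    define S where "S N = (\<Sum>n=1..N. norm (X (s n) \<omega>) ^ t)" for N
    have "(\<lambda>k. \<bar>T k ^ t / 2 ^ k * (\<Sum>n=1..2 ^ k. f k (X (s n) \<omega>))\<bar>) \<longlonglongrightarrow> 0"
      using tendsto_real_sqrt[OF elim(1)] unfolding Y1_def real_sqrt_abs real_sqrt_zero .
    then have "(\<lambda>k. T k ^ t / 2 ^ k * (\<Sum>n=1..2 ^ k. f k (X (s n) \<omega>)) + Y2 k \<omega>) \<longlonglongrightarrow> 0 + 0"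
      by (rule tendsto_add[OF tendsto_rabs_zero_cancel elim(2)])
    \<comment> \<open>Only boundedness of this convergent sequence is kept; the bound
      \<open>c0\<close> depends on \<open>\<omega>\<close>.\<close>
    then have "Bseq (\<lambda>k. T k ^ t / 2 ^ k * (\<Sum>n=1..2 ^ k. f k (X (s n) \<omega>)) + Y2 k \<omega>)"
      by (intro convergent_imp_Bseq convergentI)
    then obtain c0 where "\<And>k. norm (T k ^ t / 2 ^ k * (\<Sum>n=1..2 ^ k. f k (X (s n) \<omega>)) + Y2 k \<omega>) \<le> c0"
      unfolding Bseq_def by blast
    then have c0: "T k ^ t / 2 ^ k * (\<Sum>n=1..2 ^ k. f k (X (s n) \<omega>)) + Y2 k \<omega> \<le> c0" for k
      unfolding real_norm_def by (rule abs_le_D1)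
    \<comment> \<open>The subtracted means stay bounded as the truncation level grows, by the moment
      of order \<open>t + 1\<close>.\<close>
    have me: "T k ^ t * (\<integral>x. g k x \<partial>\<mu>) \<le> 1 + m1" for k
    proof -
      have "T k ^ t * g k x \<le> 1 + norm x ^ Suc t" for x
      proof -
        have "T k ^ t * g k x = min (norm x) (T k) ^ t"
          using T0[of k] by (simp add: g_def power_divide)
        also have "\<dots> \<le> norm x ^ t"
          using T0[of k] by (intro power_mono) auto
        also have "\<dots> \<le> 1 + norm x ^ Suc t"
        proof (cases "norm x \<le> 1")
          case True
          then show ?thesis
            by (intro add_increasing2 power_le_one) auto
        next
          case False
          then have "norm x ^ t \<le> norm x ^ Suc t"
            by (intro power_increasing) auto
          then show ?thesis
            by simp
        qed
        finally show ?thesis .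
      qed
      then have "(\<integral>x. T k ^ t * g k x \<partial>\<mu>) \<le> (\<integral>x. 1 + norm x ^ Suc t \<partial>\<mu>)"
        using moment bdd_lipschitz_integral(2)[OF g_lip] by (intro integral_mono) (auto simp del: power_Suc)
      then show ?thesis
        using moment by (simp add: m1_def mu.prob_space del: power_Suc)
    qed
    have dyadic: "S (2 ^ k) \<le> (c0 + 1 + m1) * 2 ^ k" for k
    proof -
      define e where "e = (\<integral>x. g k x \<partial>\<mu>)"
      \<comment> \<open>Centred truncated part, part cut off, and mean of the truncated
        power.\<close>
      have "norm x ^ t = T k ^ t * f k x + (norm x ^ t - min (norm x) (T k) ^ t) + T k ^ t * e" for x
        using T0[of k] by (simp add: f_def e_def g_def power_divide right_diff_distrib)
      then have "S (2 ^ k) = (\<Sum>n=1..2 ^ k. T k ^ t * f k (X (s n) \<omega>)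
          + (norm (X (s n) \<omega>) ^ t - min (norm (X (s n) \<omega>)) (T k) ^ t) + T k ^ t * e)"
        unfolding S_def by (intro sum.cong) auto
      also have "\<dots> = T k ^ t * (\<Sum>n=1..2 ^ k. f k (X (s n) \<omega>)) + 2 ^ k * Y2 k \<omega> + 2 ^ k * (T k ^ t * e)"
        by (simp add: Y2_def sum.distrib sum_distrib_left)
      also have "\<dots> = (T k ^ t / 2 ^ k * (\<Sum>n=1..2 ^ k. f k (X (s n) \<omega>)) + Y2 k \<omega> + T k ^ t * e) * 2 ^ k"
        by (simp add: field_simps)
      also have "\<dots> \<le> (c0 + 1 + m1) * 2 ^ k"
        using c0[of k] me[of k] by (intro mult_right_mono) (auto simp: e_def)
      finally show ?thesis .
    qed
    have "0 \<le> S 1"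
      by (simp add: S_def)
    then have c: "0 \<le> c0 + 1 + m1"
      using dyadic[of 0] by simp
    have "\<exists>c. \<forall>N. 1 / real N * S N \<le> c"
    proof (intro exI allI)
      fix N :: nat
      show "1 / real N * S N \<le> 2 * (c0 + 1 + m1)"
      \<comment> \<open>For \<open>N = 0\<close> the average is 0 by the convention on division.
        Otherwise \<open>S\<close> is monotone, and rounding \<open>N\<close> up to a power of 2
        costs a factor 2.\<close>
      proof (cases "N = 0")
        case False
        then obtain k where k: "2 ^ k \<le> N" "N < 2 ^ (k + 1)"
          using ex_power_ivl1[of 2 N] False by auto
        have "S N \<le> S (2 ^ (k + 1))"
          unfolding S_def using k(2) by (intro sum_mono2) auto
        also have "\<dots> \<le> (c0 + 1 + m1) * 2 ^ (k + 1)"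
          by (rule dyadic)
        also have "\<dots> = 2 * (c0 + 1 + m1) * real (2 ^ k)"
          by simp
        also have "\<dots> \<le> 2 * (c0 + 1 + m1) * real N"
          using k(1) c by (intro mult_left_mono) (simp_all only: of_nat_le_iff, simp)
        finally show ?thesis
          using False by (simp add: field_simps)
      qed (use c in simp)
    qed
    then show ?case
      by (simp only: S_def)
  qed
qed

end

subsection \<open>Sums of products of bounded Lipschitz functions\<close>

text \<open>For finite nonempty \<open>I\<close> this is an algebra: constants arise as products of
  constant factors, and scalars can be absorbed into one factor.\<close>

inductive tensor_sum :: "nat set \<Rightarrow> ((nat \<Rightarrow> 'b::real_normed_vector) \<Rightarrow> real) \<Rightarrow> bool" for I where
  prod: "(\<And>i. i \<in> I \<Longrightarrow> \<exists>B L. bdd_lipschitz B L (f i)) \<Longrightarrow> tensor_sum I (\<lambda>x. \<Prod>i\<in>I. f i (x i))"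
| add: "tensor_sum I g \<Longrightarrow> tensor_sum I h \<Longrightarrow> tensor_sum I (\<lambda>x. g x + h x)"

text \<open>Induction on both sums reduces this to two products, which are multiplied coordinate by
  coordinate.\<close>

lemma tensor_sum_mult:
  assumes "tensor_sum I g" "tensor_sum I h"
  shows "tensor_sum I (\<lambda>x. g x * h x)"
  using assms(1)
proof induction
  case (prod f)
  show ?case
    using assms(2)
  proof induction
    case (prod f')
    have "\<exists>B L. bdd_lipschitz B L (\<lambda>x. f i x * f' i x)" if "i \<in> I" for i
      using prod[OF that] \<open>\<And>i. i \<in> I \<Longrightarrow> \<exists>B L. bdd_lipschitz B L (f i)\<close>[OF that] bdd_lipschitz_mult by blast
    then show ?case
      unfolding prod.distrib[symmetric] by (rule tensor_sum.prod)
  next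
    case (add g h)
    show ?case
      unfolding distrib_left using add.IH by (rule tensor_sum.add)
  qed
next
  case (add g h')
  show ?case
    unfolding distrib_right using add.IH by (rule tensor_sum.add)
qed

lemma tensor_sum_coordinate:
  assumes "finite I" "j \<in> I" "bdd_lipschitz B L f"
  shows "tensor_sum I (\<lambda>x. f (x j))"
proof -
  have "\<exists>B L. bdd_lipschitz B L (if i = j then f else (\<lambda>_. 1))" for i
    using assms(3) bdd_lipschitz_const[of 1] by auto
  then have "tensor_sum I (\<lambda>x. \<Prod>i\<in>I. (if i = j then f else (\<lambda>_. 1)) (x i))"
    by (intro tensor_sum.prod)
  moreover have "(\<Prod>i\<in>I. (if i = j then f else (\<lambda>_. 1)) (x i)) = (\<Prod>i\<in>I. if i = j then f (x j) else 1)" for x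
    by (intro prod.cong) auto
  ultimately show ?thesis
    using assms by simp
qed

lemma tensor_sum_continuous:
  fixes g :: "(nat \<Rightarrow> 'b::real_normed_vector) \<Rightarrow> real"
  assumes "tensor_sum I g"
  shows "continuous_on S g"
  using assms
proof induction
  case (prod f)
  have "continuous_on S (\<lambda>x. f i (x i))" if "i \<in> I" for i
  proof -
    have "\<exists>B L. bdd_lipschitz B L (f i)"
      using that by (rule prod)
    then obtain B L where "bdd_lipschitz B L (f i)"
      by blast
    then have "continuous_on UNIV (f i)"
      by (rule bdd_lipschitz_continuous)
    then show ?thesis
      by (rule continuous_on_compose2) (auto intro: continuous_on_subset[OF continuous_on_product_coordinates])
  qed
  then show ?case
    by (intro continuous_on_prod)
qed (intro continuous_on_add)

text \<open>An extensional function is fixed to \<open>undefined\<close> outside \<open>I\<close>.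
  The set is thus a full product of balls and singletons, and Tychonoff's theorem applies.\<close>

lemma compact_PiE_cball:
  fixes R :: real
  shows "compact (PiE I (\<lambda>_. cball (0::'b::euclidean_space) R) :: (nat \<Rightarrow> 'b) set)"
proof -
  have eq: "PiE I (\<lambda>_. cball 0 R) = PiE UNIV (\<lambda>i. if i \<in> I then cball (0::'b) R else {undefined})"
    by (auto simp: PiE_iff extensional_def split: if_splits)
  have "compactin (product_topology (\<lambda>_. euclidean) UNIV)
      (PiE UNIV (\<lambda>i. if i \<in> I then cball (0::'b) R else {undefined}))"
    unfolding compactin_PiE by auto
  then show ?thesis
    unfolding eq euclidean_product_topology by simp
qed

text \<open>Stone-Weierstrass on a compact product of balls; the algebra separates points because
  distances in single coordinates do.\<close>

lemma tensor_sum_approx: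
  fixes F :: "(nat \<Rightarrow> 'b::euclidean_space) \<Rightarrow> real"
  assumes I: "finite I" "I \<noteq> {}" and F: "continuous_on (PiE I (\<lambda>_. cball 0 R)) F" and e: "0 < e"
  obtains g where "tensor_sum I g" "\<And>x. x \<in> PiE I (\<lambda>_. cball 0 R) \<Longrightarrow> \<bar>F x - g x\<bar> < e"
proof -
  interpret function_ring_on "Collect (tensor_sum I) :: ((nat \<Rightarrow> 'b) \<Rightarrow> real) set" "PiE I (\<lambda>_. cball 0 R)"
  proof
    show "compact (PiE I (\<lambda>_. cball (0::'b) R))"
      by (rule compact_PiE_cball)
    fix f g :: "(nat \<Rightarrow> 'b) \<Rightarrow> real"
    assume "f \<in> Collect (tensor_sum I)"
    then have f: "tensor_sum I f"
      by simp
    show "continuous_on (PiE I (\<lambda>_. cball 0 R)) f"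
      using f by (rule tensor_sum_continuous)
    assume "g \<in> Collect (tensor_sum I)"
    then have g: "tensor_sum I g"
      by simp
    show "(\<lambda>x. f x + g x) \<in> Collect (tensor_sum I)"
      using f g tensor_sum.add by blast
    show "(\<lambda>x. f x * g x) \<in> Collect (tensor_sum I)"
      using f g tensor_sum_mult by blast
  next
    fix c
    obtain j where "j \<in> I"
      using I by auto
    then show "(\<lambda>_. c) \<in> Collect (tensor_sum I)"
      using tensor_sum_coordinate[OF I(1) _ bdd_lipschitz_const] by blast
  next
    fix x y :: "nat \<Rightarrow> 'b"
    assume xy: "x \<in> PiE I (\<lambda>_. cball 0 R)" "y \<in> PiE I (\<lambda>_. cball 0 R)" "x \<noteq> y"
    then obtain j where j: "j \<in> I" "x j \<noteq> y j"
      by (metis PiE_ext)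
    \<comment> \<open>The truncated distance to \<open>x j\<close> vanishes at \<open>x\<close> and
      is positive at \<open>y\<close>.\<close>
    have "bdd_lipschitz 1 1 (\<lambda>z. min 1 (norm (z - x j)))"
      unfolding bdd_lipschitz_def
    proof (intro conjI allI)
      fix z w
      have "\<bar>min 1 (norm (z - x j)) - min 1 (norm (w - x j))\<bar> \<le> \<bar>norm (z - x j) - norm (w - x j)\<bar>"
        by (auto simp: min_def)
      also have "\<dots> \<le> norm ((z - x j) - (w - x j))"
        by (rule norm_triangle_ineq3)
      finally show "\<bar>min 1 (norm (z - x j)) - min 1 (norm (w - x j))\<bar> \<le> 1 * norm (z - w)"
        by simp
    qed (auto simp: min_def)
    then have "tensor_sum I (\<lambda>z. min 1 (norm (z j - x j)))"
      by (rule tensor_sum_coordinate[OF I(1) j(1)])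
    then show "\<exists>f\<in>Collect (tensor_sum I). f x \<noteq> f y"
      using j(2) by (intro bexI[of _ "\<lambda>z. min 1 (norm (z j - x j))"]) (auto simp: min_def)
  qed
  show thesis
    using Stone_Weierstrass_basic[OF F e] that by auto
qed

lemma closest_point_bdd_lipschitz:
  fixes f :: "'b::euclidean_space \<Rightarrow> real"
  assumes "bdd_lipschitz B L f" "0 \<le> R"
  shows "bdd_lipschitz B L (\<lambda>x. f (closest_point (cball 0 R) x))"
  unfolding bdd_lipschitz_def
proof (intro conjI allI)
  note D = bdd_lipschitzD[OF assms(1)]
  show "0 \<le> B" "0 \<le> L" "\<bar>f (closest_point (cball 0 R) x)\<bar> \<le> B" for x
    using D by auto
  fix x y
  have "\<bar>f (closest_point (cball 0 R) x) - f (closest_point (cball 0 R) y)\<bar>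
      \<le> L * dist (closest_point (cball 0 R) x) (closest_point (cball 0 R) y)"
    using D(2) by (simp add: dist_norm)
  also have "\<dots> \<le> L * dist x y"
    using D(4) assms(2) by (intro mult_left_mono closest_point_lipschitz) auto
  finally show "\<bar>f (closest_point (cball 0 R) x) - f (closest_point (cball 0 R) y)\<bar> \<le> L * norm (x - y)"
    by (simp add: dist_norm)
qed

text \<open>A Stone-Weierstrass approximation on a product of balls is not controlled outside it; composition
  with the projections to the balls repairs this and stays in the algebra.\<close>

lemma tensor_sum_closest_point:
  fixes g :: "(nat \<Rightarrow> 'b::euclidean_space) \<Rightarrow> real"
  assumes "tensor_sum I g" "0 \<le> R"
  shows "tensor_sum I (\<lambda>x. g (\<lambda>i\<in>I. closest_point (cball 0 R) (x i)))"
  using assms(1)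
proof induction
  case (prod f)
  have "\<exists>B L. bdd_lipschitz B L (\<lambda>x. f i (closest_point (cball 0 R) x))" if "i \<in> I" for i
    using prod[OF that] closest_point_bdd_lipschitz assms(2) by blast
  then have "tensor_sum I (\<lambda>x. \<Prod>i\<in>I. f i (closest_point (cball 0 R) (x i)))"
    by (rule tensor_sum.prod)
  then show ?case
    by (simp cong: prod.cong)
qed (rule tensor_sum.add)

section \<open>Strong laws for averages along \<open>qs 1, ..., qs l\<close>\<close>

locale nonconventional_averages = weakly_dependent_process M X V \<F> \<mu> C
  for M :: "'w measure" and X :: "nat \<Rightarrow> 'w \<Rightarrow> 'b::euclidean_space" and V \<F> \<mu> C +
  fixes l :: nat and qs :: "nat \<Rightarrow> nat \<Rightarrow> nat" and \<epsilon> :: real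
  assumes l: "1 \<le> l"
    and eps: "0 < \<epsilon>"
    and qs_less: "\<And>i n. i \<in> {2..l} \<Longrightarrow> 1 \<le> n \<Longrightarrow> qs (i - 1) n < qs i n"
    and qs_gap: "\<And>i n. i \<in> {2..l} \<Longrightarrow> 1 \<le> n \<Longrightarrow> real (qs (i - 1) n) + \<epsilon> * real n \<le> real (qs i n)"
    and qs_step: "\<And>i n. i \<in> {1..l} \<Longrightarrow> 1 \<le> n \<Longrightarrow> real (qs i n) + \<epsilon> \<le> real (qs i (n + 1))"
begin

lemma qs_growth:
  assumes i: "i \<in> {1..l}" and n: "1 \<le> n" "n \<le> m"
  shows "real (qs i n) + \<epsilon> * real (m - n) \<le> real (qs i m)"
  using n(2)
proof (induction rule: dec_induct)
  case (step m)
  then show ?case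
    using qs_step[OF i, of m] n by (simp add: Suc_diff_le distrib_left)
qed simp

lemma qs_separated_0:
  assumes i: "i \<in> {1..l}"
  shows "separated \<epsilon> (\<lambda>_. 0) (qs i)"
proof -
  have "\<epsilon> * real (m - n) \<le> real (qs i m)" "real (qs i n) + \<epsilon> * real (m - n) \<le> real (qs i m)"
    if "1 \<le> n" "n < m" for n m
    using qs_growth[OF i that(1), of m] that by linarith+
  then show ?thesis
    by (simp add: separated_def)
qed

text \<open>The first \<open>j\<close> factors belong to the past of \<open>qs j n\<close>, and the
  empty product to the past of 0. The first inequality comes from \<open>qs_gap\<close>, as
  \<open>\<epsilon> * (m - n) \<le> \<epsilon> * m\<close>; the second is the growth of
  \<open>qs (Suc j)\<close>.\<close>

lemma qs_separated:
  assumes j: "j < l"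
  shows "separated \<epsilon> (\<lambda>n. if j = 0 then 0 else qs j n) (qs (Suc j))"
proof (cases "j = 0")
  case True
  then show ?thesis
    using qs_separated_0[of "Suc j"] j by simp
next
  case False
  have "real (qs j m) + \<epsilon> * real (m - n) \<le> real (qs (Suc j) m)"
    "real (qs (Suc j) n) + \<epsilon> * real (m - n) \<le> real (qs (Suc j) m)" if "1 \<le> n" "n < m" for n m
  proof -
    have "\<epsilon> * real (m - n) \<le> \<epsilon> * real m"
      using eps by (intro mult_left_mono) auto
    then show "real (qs j m) + \<epsilon> * real (m - n) \<le> real (qs (Suc j) m)"
      using qs_gap[of "Suc j" m] j False that by simp
    show "real (qs (Suc j) n) + \<epsilon> * real (m - n) \<le> real (qs (Suc j) m)"
      using qs_growth[of "Suc j" n m] j that by simp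
  qed
  moreover have "qs j n \<le> qs (Suc j) n" if "1 \<le> n" for n
    using qs_less[of "Suc j" n] j False that by simp
  ultimately show ?thesis
    using False by (simp add: separated_def)
qed

text \<open>\<open>D\<close> and \<open>\<Lambda>\<close> do not depend on \<open>n\<close>, as
  \<open>slln_centered\<close> demands.\<close>

lemma past_prod:
  assumes f: "\<And>i. i \<in> {1..l} \<Longrightarrow> \<exists>B L. bdd_lipschitz B L (f i)" and j: "j \<le> l"
  shows "\<exists>D \<Lambda>. \<forall>n\<ge>1. past (if j = 0 then 0 else qs j n) D \<Lambda> (\<lambda>\<omega>. \<Prod>i=1..j. f i (X (qs i n) \<omega>))"
  using j
proof (induction j)
  case 0
  then show ?case
    using past_const[of 0 1] by auto
next
  case (Suc j)
  then obtain D \<Lambda> where D: "\<And>n. 1 \<le> n \<Longrightarrow> past (if j = 0 then 0 else qs j n) D \<Lambda> (\<lambda>\<omega>. \<Prod>i=1..j. f i (X (qs i n) \<omega>))"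
    by auto
  obtain B L where BL: "bdd_lipschitz B L (f (Suc j))"
    using f[of "Suc j"] Suc.prems by auto
  have "past (qs (Suc j) n) (D * B) (D * (L * C) + B * \<Lambda>) (\<lambda>\<omega>. \<Prod>i=1..Suc j. f i (X (qs i n) \<omega>))" if n: "1 \<le> n" for n
  proof -
    have "(if j = 0 then 0 else qs j n) \<le> qs (Suc j) n"
      using qs_separated[of j] Suc.prems n unfolding separated_def by simp
    then have "past (qs (Suc j) n) D \<Lambda> (\<lambda>\<omega>. \<Prod>i=1..j. f i (X (qs i n) \<omega>))"
      using D[OF n] past_mono by blast
    from past_mult[OF this past_observable[OF BL]] show ?thesis
      by simp
  qed
  then show ?case
    by auto
qed

text \<open>The last factor is split into its mean \<open>e\<close> and a centred part. The centred
  part averages to 0 by \<open>slln_centered\<close>, and the mean leaves \<open>e\<close> times a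
  product with one factor less.\<close>

lemma slln_prod_aux:
  assumes f: "\<And>i. i \<in> {1..l} \<Longrightarrow> \<exists>B L. bdd_lipschitz B L (f i)" and j: "j \<le> l"
  shows "AE \<omega> in M. (\<lambda>N. 1 / real N * (\<Sum>n=1..N. \<Prod>i=1..j. f i (X (qs i n) \<omega>))) \<longlonglongrightarrow> (\<Prod>i=1..j. \<integral>x. f i x \<partial>\<mu>)"
  using j
proof (induction j)
  case 0
  have "(\<lambda>N. 1 / real N * (\<Sum>n=1..N. \<Prod>i=1..0. f i (X (qs i n) \<omega>))) \<longlonglongrightarrow> (\<Prod>i=1..0. \<integral>x. f i x \<partial>\<mu>)" for \<omega>
  proof (rule tendsto_eventually)
    show "\<forall>\<^sub>F N in sequentially. 1 / real N * (\<Sum>n=1..N. \<Prod>i=1..0. f i (X (qs i n) \<omega>)) = (\<Prod>i=1..0. \<integral>x. f i x \<partial>\<mu>)"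
      \<comment> \<open>At \<open>N = 0\<close> the average is 0 instead of 1, so equality holds
        only eventually.\<close>
      using eventually_gt_at_top[of 0] by eventually_elim simp
  qed
  then show ?case
    by simp
next
  case (Suc j)
  let ?U = "\<lambda>n \<omega>. \<Prod>i=1..j. f i (X (qs i n) \<omega>)"
  define e where "e = (\<integral>x. f (Suc j) x \<partial>\<mu>)"
  obtain D \<Lambda> where D: "\<And>n. 1 \<le> n \<Longrightarrow> past (if j = 0 then 0 else qs j n) D \<Lambda> (?U n)"
    using past_prod[where f=f and j=j, OF f] Suc.prems by fastforce
  obtain B L where BL: "bdd_lipschitz B L (f (Suc j))"
    using f[of "Suc j"] Suc.prems by auto
  have "separated \<epsilon> (\<lambda>n. if j = 0 then 0 else qs j n) (qs (Suc j))"
    using Suc.prems by (intro qs_separated) simp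
  from slln_centered[OF eps D BL this] have "AE \<omega> in M.
      (\<lambda>N. 1 / real N * (\<Sum>n=1..N. ?U n \<omega> * (f (Suc j) (X (qs (Suc j) n) \<omega>) - e))) \<longlonglongrightarrow> 0"
    by (simp add: e_def)
  moreover have "AE \<omega> in M. (\<lambda>N. 1 / real N * (\<Sum>n=1..N. ?U n \<omega>)) \<longlonglongrightarrow> (\<Prod>i=1..j. \<integral>x. f i x \<partial>\<mu>)"
    using Suc by simp
  ultimately show ?case
  proof eventually_elim
    case (elim \<omega>)
    have avg: "(\<lambda>N. 1 / real N * (\<Sum>n=1..N. \<Prod>i=1..Suc j. f i (X (qs i n) \<omega>)))
       = (\<lambda>N. 1 / real N * (\<Sum>n=1..N. ?U n \<omega> * (f (Suc j) (X (qs (Suc j) n) \<omega>) - e)) + e * (1 / real N * (\<Sum>n=1..N. ?U n \<omega>)))"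
      by (simp add: right_diff_distrib sum_subtractf sum_distrib_left algebra_simps)
    have lim: "(\<Prod>i=1..Suc j. \<integral>x. f i x \<partial>\<mu>) = 0 + e * (\<Prod>i=1..j. \<integral>x. f i x \<partial>\<mu>)"
      by (simp add: e_def)
    show ?case
      unfolding avg lim by (rule tendsto_add[OF elim(1) tendsto_mult_left[OF elim(2)]])
  qed
qed

text \<open>Integrability is included so that the limits are additive in \<open>G\<close> and pass
  to approximations.\<close>

definition slln :: "((nat \<Rightarrow> 'b) \<Rightarrow> real) \<Rightarrow> bool" where
  "slln G \<longleftrightarrow> integrable (\<Pi>\<^sub>M i\<in>{1..l}. \<mu>) G \<and>
     (AE \<omega> in M. (\<lambda>N. 1 / real N * (\<Sum>n=1..N. G (\<lambda>i\<in>{1..l}. X (qs i n) \<omega>))) \<longlonglongrightarrow> (\<integral>x. G x \<partial>(\<Pi>\<^sub>M i\<in>{1..l}. \<mu>)))"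

lemma product_prob_space_mu: "product_prob_space (\<lambda>_. \<mu>)"
proof -
  interpret mu: prob_space \<mu>
    by (rule prob_space_mu)
  show ?thesis
    by unfold_locales
qed

lemma slln_tensor_sum:
  assumes "tensor_sum {1..l} G"
  shows "slln G"
  using assms
proof induction
  case (prod f)
  interpret P: product_prob_space "\<lambda>_::nat. \<mu>"
    by (rule product_prob_space_mu)
  have int: "integrable \<mu> (f i)" if "i \<in> {1..l}" for i
    using prod[OF that] bdd_lipschitz_integral(2) by blast
  then have 1: "integrable (\<Pi>\<^sub>M i\<in>{1..l}. \<mu>) (\<lambda>x. \<Prod>i\<in>{1..l}. f i (x i))"
    by (intro P.product_integrable_prod) auto
  have 2: "(\<integral>x. (\<Prod>i\<in>{1..l}. f i (x i)) \<partial>(\<Pi>\<^sub>M i\<in>{1..l}. \<mu>)) = (\<Prod>i=1..l. \<integral>x. f i x \<partial>\<mu>)"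
    using int by (intro P.product_integral_prod) auto
  have 3: "(\<Prod>i\<in>{1..l}. f i ((\<lambda>i\<in>{1..l}. X (qs i n) \<omega>) i)) = (\<Prod>i=1..l. f i (X (qs i n) \<omega>))" for n \<omega>
    by (intro prod.cong) auto
  show ?case
    unfolding slln_def 2 3 using 1 slln_prod_aux[where f=f, OF prod order_refl] by (rule conjI)
next
  case (add g h)
  have "AE \<omega> in M. (\<lambda>N. 1 / real N * (\<Sum>n=1..N. g (\<lambda>i\<in>{1..l}. X (qs i n) \<omega>) + h (\<lambda>i\<in>{1..l}. X (qs i n) \<omega>)))
      \<longlonglongrightarrow> (\<integral>x. g x \<partial>(\<Pi>\<^sub>M i\<in>{1..l}. \<mu>)) + (\<integral>x. h x \<partial>(\<Pi>\<^sub>M i\<in>{1..l}. \<mu>))"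
    using conjunct2[OF add.IH(1)[unfolded slln_def]] conjunct2[OF add.IH(2)[unfolded slln_def]]
  proof eventually_elim
    case (elim \<omega>)
    then show ?case
      unfolding sum.distrib distrib_left by (rule tendsto_add)
  qed
  then show ?case
    using add.IH by (simp add: slln_def)
qed

text \<open>The error is \<open>c / R\<close> times a function whose averages along the process are
  almost surely bounded and whose integral is finite. For fixed \<open>R\<close> let
  \<open>N\<close> tend to infinity; the remaining error is small for large
  \<open>R\<close>.\<close>

lemma slln_of_approx:
  fixes t :: nat
  assumes t: "1 \<le> t" and moment: "integrable \<mu> (\<lambda>x. norm x ^ Suc t)" and c: "0 \<le> c"
    and G: "\<And>R. 1 \<le> R \<Longrightarrow> slln (G R)"
    and approx: "\<And>R x. 1 \<le> R \<Longrightarrow> x \<in> {1..l} \<rightarrow>\<^sub>E UNIV \<Longrightarrow>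
      \<bar>F x - G R x\<bar> \<le> c / real R * (1 + (\<Sum>j=1..l. norm (x j) ^ t))"
  shows "slln F"
proof -
  note One_nat_def[simp del]
  interpret mu: prob_space \<mu>
    by (rule prob_space_mu)
  interpret P: product_prob_space "\<lambda>_::nat. \<mu>"
    by (rule product_prob_space_mu)
  interpret PM: prob_space "\<Pi>\<^sub>M i\<in>{1..l}. \<mu>"
    by (rule prob_space_PiM) (rule prob_space_mu)
  let ?P = "\<Pi>\<^sub>M i\<in>{1..l}. \<mu>"
  define H where "H x = 1 + (\<Sum>j=1..l. norm (x j) ^ t)" for x :: "nat \<Rightarrow> 'b"
  have H1: "1 \<le> H x" for x
    by (auto simp: H_def intro!: sum_nonneg)
  have sp: "space ?P = {1..l} \<rightarrow>\<^sub>E UNIV"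
    by (simp add: space_PiM space_mu)
  have intt: "integrable \<mu> (\<lambda>x. norm x ^ t)"
  proof (rule Bochner_Integration.integrable_bound)
    show "integrable \<mu> (\<lambda>x. 1 + norm x ^ Suc t)"
      using moment by (simp del: power_Suc)
    have "norm x ^ t \<le> 1 + norm x ^ Suc t" for x :: 'b
    proof (cases "norm x \<le> 1")
      case True
      then show ?thesis
        by (intro add_increasing2 power_le_one) auto
    next
      case False
      then have "norm x ^ t \<le> norm x ^ Suc t"
        by (intro power_increasing) auto
      then show ?thesis
        by simp
    qed
    then show "AE x in \<mu>. norm (norm x ^ t) \<le> norm (1 + norm x ^ Suc t)"
      by (intro AE_I2) (simp add: abs_of_nonneg del: power_Suc)
  qed simp
  have intH: "integrable ?P H"
  proof -
    have "integrable ?P (\<lambda>x. norm (x j) ^ t)" if "j \<in> {1..l}" for j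
    proof -
      \<comment> \<open>The power in coordinate \<open>j\<close> is written as a product whose other
        factors are 1.\<close>
      have "integrable ?P (\<lambda>x. \<Prod>i\<in>{1..l}. (if i = j then \<lambda>x. norm x ^ t else (\<lambda>_. 1)) (x i))"
        using intt by (intro P.product_integrable_prod) auto
      moreover have "(\<Prod>i\<in>{1..l}. (if i = j then \<lambda>x. norm x ^ t else (\<lambda>_. 1)) (x i)) = (\<Prod>i\<in>{1..l}. if i = j then norm (x j) ^ t else 1)" for x :: "nat \<Rightarrow> 'b"
        by (intro prod.cong) auto
      ultimately show ?thesis
        using that by simp
    qed
    then show ?thesis
      unfolding H_def
      by (intro Bochner_Integration.integrable_add Bochner_Integration.integrable_sum PM.integrable_const)
  qed
  have intG: "integrable ?P (G R)" if "1 \<le> R" for R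
    using G[OF that] by (simp add: slln_def)
  have approx': "\<bar>F x - G R x\<bar> \<le> c / real R * H x" if "1 \<le> R" "x \<in> {1..l} \<rightarrow>\<^sub>E UNIV" for R x
    using approx[OF that] by (simp add: H_def)
  \<comment> \<open>Measurability of \<open>F\<close> is inherited from the \<open>G R\<close>,
    which converge to it pointwise.\<close>
  have [measurable]: "F \<in> borel_measurable ?P"
  proof (rule borel_measurable_LIMSEQ_real)
    fix x
    assume "x \<in> space ?P"
    then have x: "x \<in> {1..l} \<rightarrow>\<^sub>E UNIV"
      by (simp add: sp)
    have lim0: "(\<lambda>R. c * H x / real (Suc R)) \<longlonglongrightarrow> 0"
      by (rule LIMSEQ_Suc[OF lim_const_over_n])
    have "norm (G (Suc R) x - F x) \<le> c * H x / real (Suc R)" for R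
      using approx'[OF _ x, of "Suc R"] by (simp add: abs_minus_commute One_nat_def)
    then have "(\<lambda>R. G (Suc R) x - F x) \<longlonglongrightarrow> 0"
      by (intro Lim_null_comparison[OF _ lim0] always_eventually allI)
    then show "(\<lambda>R. G (Suc R) x) \<longlonglongrightarrow> F x"
      by (rule LIM_zero_cancel)
  qed (use intG in auto)
  have intF: "integrable ?P F"
  proof (rule Bochner_Integration.integrable_bound)
    show "integrable ?P (\<lambda>x. \<bar>G 1 x\<bar> + c * H x)"
      using intG[of 1] intH by simp
    show "AE x in ?P. norm (F x) \<le> norm (\<bar>G 1 x\<bar> + c * H x)"
    proof (rule AE_I2)
      fix x
      assume "x \<in> space ?P"
      then have "\<bar>F x - G 1 x\<bar> \<le> c * H x"
        using approx'[of 1 x] by (simp add: sp)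
      then show "norm (F x) \<le> norm (\<bar>G 1 x\<bar> + c * H x)"
        by simp
    qed
  qed simp
  define h where "h = (\<integral>x. H x \<partial>?P)"
  have h: "\<bar>(\<integral>x. F x \<partial>?P) - (\<integral>x. G R x \<partial>?P)\<bar> \<le> c / real R * h" if R: "1 \<le> R" for R
  proof -
    have "\<bar>(\<integral>x. F x \<partial>?P) - (\<integral>x. G R x \<partial>?P)\<bar> = \<bar>\<integral>x. F x - G R x \<partial>?P\<bar>"
      using intF intG[OF R] by simp
    also have "\<dots> \<le> (\<integral>x. \<bar>F x - G R x\<bar> \<partial>?P)"
      by (rule integral_abs_bound)
    also have "\<dots> \<le> (\<integral>x. c / real R * H x \<partial>?P)"
      using intF intG[OF R] intH approx'[OF R] by (intro integral_mono) (auto simp: sp)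
    also have "\<dots> = c / real R * h"
      by (simp add: h_def)
    finally show ?thesis .
  qed
  have h0: "0 \<le> h"
    unfolding h_def by (intro integral_nonneg_AE AE_I2 order_trans[OF zero_le_one H1])
  have "AE \<omega> in M. \<forall>j\<in>{1..l}. \<exists>c. \<forall>N. 1 / real N * (\<Sum>n=1..N. norm (X (qs j n) \<omega>) ^ t) \<le> c"
    using average_powers_bounded[OF eps qs_separated_0 t moment] by (intro AE_finite_allI) auto
  \<comment> \<open>One null set serves all integers \<open>R\<close>, so \<open>R\<close> may be
    chosen depending on \<open>\<omega>\<close>.\<close>
  moreover have "AE \<omega> in M. \<forall>R. (\<lambda>N. 1 / real N * (\<Sum>n=1..N. G (Suc R) (\<lambda>i\<in>{1..l}. X (qs i n) \<omega>))) \<longlonglongrightarrow> (\<integral>x. G (Suc R) x \<partial>?P)"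
    unfolding AE_all_countable using G by (simp add: slln_def)
  ultimately have "AE \<omega> in M. (\<lambda>N. 1 / real N * (\<Sum>n=1..N. F (\<lambda>i\<in>{1..l}. X (qs i n) \<omega>))) \<longlonglongrightarrow> (\<integral>x. F x \<partial>?P)"
  proof eventually_elim
    case (elim \<omega>)
    let ?x = "\<lambda>n. \<lambda>i\<in>{1..l}. X (qs i n) \<omega>"
    obtain b where b: "\<And>j N. j \<in> {1..l} \<Longrightarrow> 1 / real N * (\<Sum>n=1..N. norm (X (qs j n) \<omega>) ^ t) \<le> b j"
      using elim(1) by metis
    define b' where "b' = 1 + (\<Sum>j=1..l. b j)"
    have avgH: "1 / real N * (\<Sum>n=1..N. H (?x n)) \<le> b'" for N
    proof -
      have "(\<Sum>n=1..N. H (?x n)) = real N + (\<Sum>j=1..l. \<Sum>n=1..N. norm (X (qs j n) \<omega>) ^ t)"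
        unfolding H_def sum.distrib by (subst sum.swap) simp
      then have "1 / real N * (\<Sum>n=1..N. H (?x n)) \<le> 1 + (\<Sum>j=1..l. 1 / real N * (\<Sum>n=1..N. norm (X (qs j n) \<omega>) ^ t))"
        by (cases "N = 0") (simp_all add: add_divide_distrib sum_divide_distrib)
      also have "\<dots> \<le> b'"
        unfolding b'_def by (intro add_left_mono sum_mono b)
      finally show ?thesis .
    qed
    have b'0: "0 \<le> b'"
      using avgH[of 0] by simp
    show ?case
    proof (rule LIMSEQ_I)
      fix e :: real
      assume e: "0 < e"
      \<comment> \<open>Makes the errors in the average and in the integral less than
        \<open>e / 3\<close> together; \<open>b'\<close> depends on \<open>\<omega>\<close>, hence
        so does \<open>R0\<close>.\<close>
      obtain R0 :: nat where R0: "3 * c * (b' + h) / e < real R0"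
        using reals_Archimedean2 by blast
      define R where "R = Suc R0"
      have small: "c / real R * b' + c / real R * h < 2 * e / 3"
      proof -
        have R: "0 < real R" "3 * c * (b' + h) / e < real R"
          using R0 by (simp_all add: R_def)
        then have "c * (b' + h) / real R < e / 3"
          using e by (simp add: field_simps)
        moreover have "c / real R * b' + c / real R * h = c * (b' + h) / real R"
          by (simp add: distrib_left add_divide_distrib)
        ultimately show ?thesis
          using e by linarith
      qed
      obtain N0 where N0: "\<And>N. N \<ge> N0 \<Longrightarrow> norm (1 / real N * (\<Sum>n=1..N. G R (?x n)) - (\<integral>x. G R x \<partial>?P)) < e / 3"
        using LIMSEQ_D[OF elim(2)[rule_format, of R0], of "e / 3"] e unfolding R_def by auto
      show "\<exists>no. \<forall>N\<ge>no. norm (1 / real N * (\<Sum>n=1..N. F (?x n)) - (\<integral>x. F x \<partial>?P)) < e"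
      proof (intro exI allI impI)
        fix N
        assume N: "N0 \<le> N"
        have "\<bar>1 / real N * (\<Sum>n=1..N. F (?x n)) - 1 / real N * (\<Sum>n=1..N. G R (?x n))\<bar>
            = 1 / real N * \<bar>\<Sum>n=1..N. F (?x n) - G R (?x n)\<bar>"
          by (simp add: sum_subtractf abs_mult flip: right_diff_distrib diff_divide_distrib)
        also have "\<dots> \<le> 1 / real N * (\<Sum>n=1..N. c / real R * H (?x n))"
        proof (intro mult_left_mono order_trans[OF sum_abs] sum_mono)
          show "\<bar>F (?x n) - G R (?x n)\<bar> \<le> c / real R * H (?x n)" for n
            by (rule approx') (auto simp: R_def)
        qed simp
        also have "\<dots> = c / real R * (1 / real N * (\<Sum>n=1..N. H (?x n)))"
          by (simp add: sum_distrib_left mult.commute)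
        also have "\<dots> \<le> c / real R * b'"
          using c avgH by (intro mult_left_mono) auto
        finally show "norm (1 / real N * (\<Sum>n=1..N. F (?x n)) - (\<integral>x. F x \<partial>?P)) < e"
          using N0[OF N] h[of R] small unfolding R_def real_norm_def by linarith
      qed
    qed
  qed
  then show ?thesis
    using intF by (simp add: slln_def)
qed

end

subsection \<open>Locally Hoelder functions\<close>

lemma size_minus_half_bound:
  assumes "size_minus_half a"
  obtains C where "0 < C" "\<And>n. 1 \<le> n \<Longrightarrow> a n \<le> ennreal (C / sqrt (real n))"
proof -
  have fin: "a n < \<top>" if "1 \<le> n" for n
    using assms that by (simp add: size_minus_half_def)
  obtain L where L: "\<forall>n\<ge>1. 0 < L n" and ex: "\<exists>n0. \<forall>n\<ge>n0. L n \<le> L (Suc n)"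
    and O: "(\<lambda>n. enn2real (a n)) \<in> O(\<lambda>n. 1 / (real n powr (1/2) * L n))"
    using assms unfolding size_minus_half_def by blast
  obtain n0 where mono: "\<And>n. n0 \<le> n \<Longrightarrow> L n \<le> L (Suc n)"
    using ex by blast
  obtain c where c: "0 < c" and
    "\<forall>\<^sub>F n in sequentially. norm (enn2real (a n)) \<le> c * norm (1 / (real n powr (1/2) * L n))"
    using O by (elim landau_o.bigE)
  then obtain N1 where N1: "\<And>n. N1 \<le> n \<Longrightarrow> enn2real (a n) \<le> c * \<bar>1 / (real n powr (1/2) * L n)\<bar>"
    unfolding eventually_sequentially by auto
  \<comment> \<open>From \<open>N\<close> on the sequence \<open>L\<close> is nondecreasing, so it
    stays above the positive number \<open>L N\<close> and may be replaced by it; \<open>Suc\<close>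
    ensures \<open>1 \<le> N\<close>. Finitely many earlier terms are absorbed into
    \<open>C2\<close>.\<close>
  define N where "N = Suc n0"
  have LN: "0 < L N"
    using L by (simp add: N_def)
  have Lge: "L N \<le> L n" if "N \<le> n" for n
    using that
  proof (induction rule: dec_induct)
    case (step n)
    then show ?case
      using mono[of n] by (simp add: N_def)
  qed simp
  define N2 where "N2 = max N N1"
  define C2 where "C2 = (\<Sum>n\<le>N2. enn2real (a n) * sqrt (real n))"
  have C2: "0 \<le> C2"
    by (auto simp: C2_def intro!: sum_nonneg)
  define C where "C = c / L N + C2"
  have "enn2real (a n) \<le> C / sqrt (real n)" if n: "1 \<le> n" for n
  proof -
    have "enn2real (a n) * sqrt (real n) \<le> C"
    proof (cases "n \<le> N2")
      case True
      then have "enn2real (a n) * sqrt (real n) \<le> C2"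
        unfolding C2_def by (intro member_le_sum) auto
      then show ?thesis
        using c LN by (simp add: C_def add_increasing)
    next
      case False
      then have n2: "N \<le> n" "N1 \<le> n"
        by (auto simp: N2_def)
      have Ln: "0 < L n"
        using L n by simp
      have "enn2real (a n) \<le> c / (sqrt (real n) * L n)"
        using N1[OF n2(2)] n Ln by (simp add: powr_half_sqrt abs_mult)
      then have "enn2real (a n) * sqrt (real n) \<le> c / L n"
        using n Ln by (simp add: field_simps)
      also have "\<dots> \<le> c / L N"
        using c LN Lge[OF n2(1)] by (intro divide_left_mono) auto
      finally show ?thesis
        using C2 by (simp add: C_def)
    qed
    then show ?thesis
      using n by (simp add: field_simps)
  qed
  then have "a n \<le> ennreal (C / sqrt (real n))" if "1 \<le> n" for n
    using that fin[OF that] by (metis ennreal_enn2real ennreal_leI)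
  moreover have "0 < C"
    using c LN C2 by (simp add: C_def add_pos_nonneg)
  ultimately show thesis
    using that by blast
qed

lemma ennpowr_le_imp_le:
  assumes "ennpowr x \<theta> \<le> ennreal y" "0 < \<theta>" "0 < y"
  shows "x \<le> ennreal (y powr (1 / \<theta>))"
proof -
  have fin: "x \<noteq> \<top>"
    using assms(1) by (auto simp: ennpowr_def top_unique)
  then have "enn2real x powr \<theta> \<le> y"
    using assms by (simp add: ennpowr_def)
  then have "(enn2real x powr \<theta>) powr (1 / \<theta>) \<le> y powr (1 / \<theta>)"
    using assms(2) by (intro powr_mono2) auto
  then have "enn2real x \<le> y powr (1 / \<theta>)"
    using assms(2) by (simp add: powr_powr)
  then show ?thesis
    using fin by (metis ennreal_enn2real ennreal_leI less_top)
qed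

text \<open>It makes functions bounded by 1 admissible in the supremum
  \<open>varpi_alg\<close>.\<close>

lemma Lr_norm_le_1:
  assumes "prob_space M" "\<And>\<omega>. norm (g \<omega>) \<le> 1" "1 \<le> q"
  shows "Lr_norm M q g \<le> 1"
proof -
  interpret prob_space M by fact
  have "(\<integral>\<^sup>+\<omega>. ennreal (norm (g \<omega>) powr q) \<partial>M) \<le> (\<integral>\<^sup>+\<omega>. 1 \<partial>M)"
    using assms by (intro nn_integral_mono) (auto intro!: powr_le1)
  then have le: "(\<integral>\<^sup>+\<omega>. ennreal (norm (g \<omega>) powr q) \<partial>M) \<le> 1" (is "?I \<le> _")
    by (simp add: emeasure_space_1)
  then have "enn2real ?I powr (1 / q) \<le> 1"
    using assms(3) by (intro powr_le1) (auto simp: enn2real_leI)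
  moreover have "?I \<noteq> \<top>"
    using le by (auto simp: top_unique)
  ultimately show ?thesis
    by (simp add: Lr_norm_def ennpowr_def)
qed

lemma vec_cond_exp_measurable:
  fixes Y :: "'w \<Rightarrow> real ^ 'd"
  shows "vec_cond_exp M G Y \<in> borel_measurable G"
proof (rule borel_measurable_euclidean_space[THEN iffD2], intro ballI)
  fix b :: "real ^ 'd"
  assume "b \<in> Basis"
  then obtain i where "b = axis i 1"
    by (auto simp: Basis_vec_def)
  then have "(\<lambda>\<omega>. vec_cond_exp M G Y \<omega> \<bullet> b) = real_cond_exp M G (\<lambda>\<omega>. Y \<omega> $ i)"
    by (auto simp: vec_cond_exp_def inner_axis)
  then show "(\<lambda>\<omega>. vec_cond_exp M G Y \<omega> \<bullet> b) \<in> borel_measurable G"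
    by simp
qed

section \<open>Continuity and truncation of \<open>F\<close>\<close>

lemma locally_hoelder_continuous_on:
  fixes F :: "(nat \<Rightarrow> 'b::euclidean_space) \<Rightarrow> real"
  assumes nn: "0 \<le> K" "0 \<le> \<iota>" "0 < \<kappa>"
    and F: "\<And>x y. x \<in> I \<rightarrow>\<^sub>E UNIV \<Longrightarrow> y \<in> I \<rightarrow>\<^sub>E UNIV \<Longrightarrow>
      \<bar>F x - F y\<bar> \<le> K * (1 + (\<Sum>j\<in>I. norm (x j) powr \<iota>) + (\<Sum>j\<in>I. norm (y j) powr \<iota>))
                      * (\<Sum>j\<in>I. norm (x j - y j) powr \<kappa>)"
  shows "continuous_on (PiE I (\<lambda>_. cball 0 R)) F"
  unfolding continuous_on_def
proof
  fix x :: "nat \<Rightarrow> 'b"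
  assume x: "x \<in> PiE I (\<lambda>_. cball 0 R)"
  let ?S = "PiE I (\<lambda>_. cball 0 R) :: (nat \<Rightarrow> 'b) set"
  \<comment> \<open>On the product of balls the coordinates of \<open>y\<close> are at most
    \<open>R\<close>, so the growth factor is bounded independently of \<open>y\<close>.\<close>
  define B where "B = K * (1 + (\<Sum>j\<in>I. norm (x j) powr \<iota>) + (\<Sum>j\<in>I. R powr \<iota>))"
  have "((\<lambda>y. B * (\<Sum>j\<in>I. norm (y j - x j) powr \<kappa>)) \<longlongrightarrow> B * (\<Sum>j\<in>I. 0)) (at x within ?S)"
  proof (intro tendsto_mult_left tendsto_sum)
    fix j
    have "continuous_on ?S (\<lambda>y. y j)"
      by (rule continuous_on_subset[OF continuous_on_product_coordinates]) simp
    then have "((\<lambda>y. y j) \<longlongrightarrow> x j) (at x within ?S)"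
      using x unfolding continuous_on_def by blast
    then have "((\<lambda>y. norm (y j - x j)) \<longlongrightarrow> 0) (at x within ?S)"
      by (simp add: LIM_zero_iff tendsto_norm_zero_iff)
    then show "((\<lambda>y. norm (y j - x j) powr \<kappa>) \<longlongrightarrow> 0) (at x within ?S)"
      using nn(3) by (intro tendsto_zero_powrI[where b=\<kappa>]) auto
  qed
  then have lim0: "((\<lambda>y. B * (\<Sum>j\<in>I. norm (y j - x j) powr \<kappa>)) \<longlongrightarrow> 0) (at x within ?S)"
    by simp
  have "norm (F y - F x) \<le> B * (\<Sum>j\<in>I. norm (y j - x j) powr \<kappa>)" if y: "y \<in> ?S" for y
  proof -
    have "\<bar>F x - F y\<bar> \<le> K * (1 + (\<Sum>j\<in>I. norm (x j) powr \<iota>) + (\<Sum>j\<in>I. norm (y j) powr \<iota>))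
        * (\<Sum>j\<in>I. norm (x j - y j) powr \<kappa>)"
      using x y by (intro F) (auto simp: PiE_iff)
    also have "\<dots> \<le> B * (\<Sum>j\<in>I. norm (x j - y j) powr \<kappa>)"
      unfolding B_def using nn y
      by (intro mult_right_mono mult_left_mono add_left_mono sum_mono powr_mono2 sum_nonneg) (auto simp: PiE_iff)
    finally show ?thesis
      by (simp add: abs_minus_commute norm_minus_commute)
  qed
  then have "\<forall>\<^sub>F y in at x within ?S. norm (F y - F x) \<le> B * (\<Sum>j\<in>I. norm (y j - x j) powr \<kappa>)"
    by (auto simp: eventually_at_filter)
  then have "((\<lambda>y. F y - F x) \<longlongrightarrow> 0) (at x within ?S)"
    using lim0 by (rule Lim_null_comparison)
  then show "(F \<longlongrightarrow> F x) (at x within ?S)"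
    by (rule LIM_zero_cancel)
qed

lemma closest_point_cball_norm_le:
  fixes x :: "'b::euclidean_space"
  assumes "0 \<le> R"
  shows "norm (closest_point (cball 0 R) x) \<le> norm x" "norm (closest_point (cball 0 R) x) \<le> R"
proof -
  have "dist (closest_point (cball 0 R) x) (closest_point (cball 0 R) 0) \<le> dist x 0"
    using assms by (intro closest_point_lipschitz) auto
  then show "norm (closest_point (cball 0 R) x) \<le> norm x"
    using assms by (simp add: closest_point_self)
  show "norm (closest_point (cball 0 R) x) \<le> R"
    using closest_point_in_set[of "cball 0 R" x] assms by simp
qed

text \<open>If no coordinate leaves the ball, the error is 0. Otherwise some coordinate exceeds
  \<open>R\<close>, and replacing the exponent \<open>\<iota>\<close> by
  \<open>t \<ge> \<iota> + 1\<close> gains the factor \<open>1 / R\<close>; the growth bound applies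
  to both values of \<open>F\<close>.\<close>

lemma truncation_error:
  fixes F :: "(nat \<Rightarrow> 'b::euclidean_space) \<Rightarrow> real" and t :: nat
  assumes I: "finite I" and nn: "0 \<le> K" "0 \<le> \<iota>" and t: "\<iota> + 1 \<le> real t" and R: "1 \<le> R"
    and F: "\<And>x. x \<in> I \<rightarrow>\<^sub>E UNIV \<Longrightarrow> \<bar>F x\<bar> \<le> K * (1 + (\<Sum>j\<in>I. norm (x j) powr \<iota>))"
    and x: "x \<in> I \<rightarrow>\<^sub>E UNIV"
  shows "\<bar>F x - F (\<lambda>i\<in>I. closest_point (cball 0 R) (x i))\<bar>
    \<le> 2 * K * (1 + real (card I)) / R * (\<Sum>j\<in>I. norm (x j) ^ t)"
proof (cases "\<forall>i\<in>I. norm (x i) \<le> R")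
  case True
  then have "(\<lambda>i\<in>I. closest_point (cball 0 R) (x i)) = x"
    using x by (intro ext) (auto simp: closest_point_self PiE_iff extensional_def)
  then show ?thesis
    using nn R by (simp add: sum_nonneg)
next
  case False
  then obtain j where j: "j \<in> I" "R < norm (x j)"
    by auto
  let ?y = "\<lambda>i\<in>I. closest_point (cball 0 R) (x i)"
  define T where "T = (\<Sum>j\<in>I. norm (x j) ^ t)"
  have le_T: "norm (x i) ^ t \<le> T" if "i \<in> I" for i
    unfolding T_def using I that by (intro member_le_sum) auto
  have big: "R * norm v powr \<iota> \<le> norm v ^ t" if "R \<le> norm v" for v :: 'b
  proof -
    have v: "1 \<le> norm v"
      using that R by simp
    have "R * norm v powr \<iota> \<le> norm v * norm v powr \<iota>"
      using that by (intro mult_right_mono) auto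
    also have "\<dots> = norm v powr (\<iota> + 1)"
      using v by (simp add: powr_add)
    also have "\<dots> \<le> norm v powr real t"
      using t v by (intro powr_mono) auto
    also have "\<dots> = norm v ^ t"
      using v by (intro powr_realpow) linarith
    finally show ?thesis .
  qed
  have jT: "R * norm (x j) powr \<iota> \<le> T"
    using big[of "x j"] le_T[OF j(1)] j(2) by simp
  \<comment> \<open>Coordinates inside the ball are dominated by the exceptional coordinate
    \<open>j\<close>.\<close>
  have le_TR: "norm (x i) powr \<iota> \<le> T / R" if i: "i \<in> I" for i
  proof (cases "R \<le> norm (x i)")
    case True
    then show ?thesis
      using big[OF True] le_T[OF i] R by (simp add: field_simps)
  next
    case False
    then have "norm (x i) powr \<iota> \<le> norm (x j) powr \<iota>"
      using nn j(2) by (intro powr_mono2) auto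
    then have "R * norm (x i) powr \<iota> \<le> T"
      using jT R by (smt (verit) mult_left_mono)
    then show ?thesis
      using R by (simp add: field_simps)
  qed
  have "1 \<le> norm (x j) powr \<iota>"
    using j(2) R nn by (intro ge_one_powr_ge_zero) auto
  then have one: "1 \<le> T / R"
    using le_TR[OF j(1)] by linarith
  have "(\<Sum>i\<in>I. norm (x i) powr \<iota>) \<le> real (card I) * (T / R)"
    using le_TR by (rule sum_bounded_above)
  then have growth: "1 + (\<Sum>i\<in>I. norm (x i) powr \<iota>) \<le> (1 + real (card I)) * (T / R)"
    unfolding distrib_right using one by simp
  have "\<bar>F x\<bar> \<le> K * (1 + (\<Sum>i\<in>I. norm (x i) powr \<iota>))"
    using x by (rule F)
  moreover have "\<bar>F ?y\<bar> \<le> K * (1 + (\<Sum>i\<in>I. norm (x i) powr \<iota>))"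
  proof -
    have "\<bar>F ?y\<bar> \<le> K * (1 + (\<Sum>i\<in>I. norm (?y i) powr \<iota>))"
      by (rule F) auto
    also have "\<dots> \<le> K * (1 + (\<Sum>i\<in>I. norm (x i) powr \<iota>))"
      using nn R closest_point_cball_norm_le(1)[of R]
      by (intro mult_left_mono add_left_mono sum_mono powr_mono2) auto
    finally show ?thesis .
  qed
  ultimately have "\<bar>F x - F ?y\<bar> \<le> 2 * (K * (1 + (\<Sum>i\<in>I. norm (x i) powr \<iota>)))"
    by linarith
  also have "\<dots> \<le> 2 * (K * ((1 + real (card I)) * (T / R)))"
    using growth nn by (intro mult_left_mono) auto
  finally show ?thesis
    by (simp add: T_def)
qed

text \<open>\<open>R\<close> is both the radius of the balls and the inverse of the accuracy of the
  Stone-Weierstrass approximation.\<close>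

lemma (in nonconventional_averages) slln_locally_hoelder:
  fixes F :: "(nat \<Rightarrow> 'b) \<Rightarrow> real" and t :: nat
  assumes const: "0 \<le> \<iota>" "0 \<le> K" "0 < \<kappa>"
    and F_hoelder: "\<And>x y. x \<in> {1..l} \<rightarrow>\<^sub>E UNIV \<Longrightarrow> y \<in> {1..l} \<rightarrow>\<^sub>E UNIV \<Longrightarrow>
      \<bar>F x - F y\<bar> \<le> K * (1 + (\<Sum>j=1..l. norm (x j) powr \<iota>) + (\<Sum>j=1..l. norm (y j) powr \<iota>))
                      * (\<Sum>j=1..l. norm (x j - y j) powr \<kappa>)"
    and F_growth: "\<And>x. x \<in> {1..l} \<rightarrow>\<^sub>E UNIV \<Longrightarrow> \<bar>F x\<bar> \<le> K * (1 + (\<Sum>j=1..l. norm (x j) powr \<iota>))"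
    and t: "\<iota> + 1 \<le> real t" and moment: "integrable \<mu> (\<lambda>x. norm x ^ Suc t)"
  shows "slln F"
proof -
  let ?S = "\<lambda>R::nat. PiE {1..l} (\<lambda>_. cball (0::'b) (real R))"
  have "\<exists>g. tensor_sum {1..l} g \<and> (\<forall>x\<in>?S R. \<bar>F x - g x\<bar> < 1 / real R)" if R: "1 \<le> R" for R
  proof -
    have "continuous_on (?S R) F"
      using const(2,1,3) F_hoelder by (rule locally_hoelder_continuous_on)
    then obtain g where "tensor_sum {1..l} g" "\<And>x. x \<in> ?S R \<Longrightarrow> \<bar>F x - g x\<bar> < 1 / real R"
      by (rule tensor_sum_approx[rotated 2, of _ _ _ "1 / real R"]) (use l R in auto)
    then show ?thesis
      by blast
  qed
  then obtain g where g: "\<And>R. 1 \<le> R \<Longrightarrow> tensor_sum {1..l} (g R)"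
    "\<And>R x. 1 \<le> R \<Longrightarrow> x \<in> ?S R \<Longrightarrow> \<bar>F x - g R x\<bar> < 1 / real R"
    by metis
  define clamp where "clamp R x = (\<lambda>i\<in>{1..l}. closest_point (cball 0 (real R)) (x i))" for R :: nat and x :: "nat \<Rightarrow> 'b"
  \<comment> \<open>The first summand is the constant of \<open>truncation_error\<close>; the 1 is
    for the approximation error \<open>1 / R\<close>.\<close>
  define c where "c = 2 * K * (1 + real l) + 1"
  show ?thesis
  proof (rule slln_of_approx[of t c "\<lambda>R x. g R (clamp R x)"])
    show "1 \<le> t"
      using t const(1) by linarith
    show "0 \<le> c"
      using const by (simp add: c_def)
    fix R :: nat
    assume R: "1 \<le> R"
    show "slln (\<lambda>x. g R (clamp R x))"
      unfolding clamp_def using g(1)[OF R] by (intro slln_tensor_sum tensor_sum_closest_point) auto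
    fix x :: "nat \<Rightarrow> 'b"
    assume x: "x \<in> {1..l} \<rightarrow>\<^sub>E UNIV"
    define T where "T = (\<Sum>j=1..l. norm (x j) ^ t)"
    have T: "0 \<le> T"
      by (auto simp: T_def intro!: sum_nonneg)
    have "clamp R x \<in> ?S R"
      using closest_point_cball_norm_le(2)[of "real R"] by (auto simp: clamp_def)
    then have "\<bar>F (clamp R x) - g R (clamp R x)\<bar> < 1 / real R"
      by (rule g(2)[OF R])
    moreover have "\<bar>F x - F (clamp R x)\<bar> \<le> 2 * K * (1 + real l) / real R * T"
      using truncation_error[of "{1..l}" K \<iota> t "real R" F x] const t R F_growth x
      by (simp add: clamp_def T_def)
    ultimately have "\<bar>F x - g R (clamp R x)\<bar> \<le> 2 * K * (1 + real l) / real R * T + 1 / real R"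
      by linarith
    also have "\<dots> = (2 * K * (1 + real l) * T + 1) / real R"
      by (simp add: add_divide_distrib)
    also have "\<dots> \<le> (c * (1 + T)) / real R"
      using T const by (intro divide_right_mono) (auto simp: c_def algebra_simps)
    finally show "\<bar>F x - g R (clamp R x)\<bar> \<le> c / real R * (1 + (\<Sum>j=1..l. norm (x j) ^ t))"
      by (simp add: T_def)
  qed (fact moment)
qed

section \<open>The strong law under the conditions on the coefficients\<close>

theorem theorem2p2:
  fixes M :: "'w measure"
    and \<mu> :: "(real ^ 'd) measure"
    and X :: "nat \<Rightarrow> 'w \<Rightarrow> real ^ 'd"
    and \<F> :: "enat \<Rightarrow> enat \<Rightarrow> 'w measure"
    and l :: nat
    and F :: "(nat \<Rightarrow> real ^ 'd) \<Rightarrow> real"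
    and K \<iota> \<kappa> \<epsilon> :: real
    and qs :: "nat \<Rightarrow> nat \<Rightarrow> nat"
    and p q \<theta> m :: real
  assumes prob: "prob_space M"
    and l: "1 \<le> l"
    and X_meas: "\<And>n. X n \<in> borel_measurable M"
    and X_distr: "\<And>n. distr M borel (X n) = \<mu>"
    and family: "sigma_family M \<F>"
    and const: "0 < \<iota>" "0 < K" "0 < \<kappa>" "\<kappa> \<le> 1"
    and F_hoelder: "\<And>x y. x \<in> {1..l} \<rightarrow>\<^sub>E UNIV \<Longrightarrow> y \<in> {1..l} \<rightarrow>\<^sub>E UNIV \<Longrightarrow>
      \<bar>F x - F y\<bar> \<le> K * (1 + (\<Sum>j=1..l. norm (x j) powr \<iota>) + (\<Sum>j=1..l. norm (y j) powr \<iota>))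
                      * (\<Sum>j=1..l. norm (x j - y j) powr \<kappa>)"
    and F_growth: "\<And>x. x \<in> {1..l} \<rightarrow>\<^sub>E UNIV \<Longrightarrow>
      \<bar>F x\<bar> \<le> K * (1 + (\<Sum>j=1..l. norm (x j) powr \<iota>))"
    and eps: "0 < \<epsilon>" "\<epsilon> \<le> 1"
    and qs_pos: "\<And>i n. i \<in> {1..l} \<Longrightarrow> 1 \<le> n \<Longrightarrow> 0 < qs i n"
    and qs_less: "\<And>i n. i \<in> {2..l} \<Longrightarrow> 1 \<le> n \<Longrightarrow> qs (i - 1) n < qs i n"
    and qs_gap: "\<And>i n. i \<in> {2..l} \<Longrightarrow> 1 \<le> n \<Longrightarrow>
      real (qs i n) \<ge> real (qs (i - 1) n) + \<epsilon> * real n"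
    and qs_step: "\<And>i n. i \<in> {1..l} \<Longrightarrow> 1 \<le> n \<Longrightarrow> real (qs i (n + 1)) \<ge> real (qs i n) + \<epsilon>"
    and params: "1 \<le> p" "1 \<le> q" "0 < \<theta>" "0 < m"
    and theta: "\<theta> < \<kappa> - real ((l - 1) * CARD('d)) / p"
    and exponents: "1 / 2 \<ge> 1 / p + (\<iota> + 2) / m + \<theta> / q"
    and moments: "gamma_moment \<mu> m + gamma_moment \<mu> (2 * q * (\<iota> + 2)) < \<infinity>"
    and size: "size_minus_half (\<lambda>n. varpi_coeff M \<F> q p n + ennpowr (beta_coeff M \<F> X q n) \<theta>)"
  shows "AE \<omega> in M.
    (\<lambda>N. (1 / real N) * (\<Sum>n=1..N. F (\<lambda>i\<in>{1..l}. X (qs i n) \<omega>)))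
      \<longlonglongrightarrow> (\<integral>x. F x \<partial>(\<Pi>\<^sub>M i\<in>{1..l}. \<mu>))"
proof -
  interpret prob_space M by (fact prob)
  let ?a = "\<lambda>n. varpi_coeff M \<F> q p n + ennpowr (beta_coeff M \<F> X q n) \<theta>"
  obtain C where C: "0 < C" and a: "\<And>n. 1 \<le> n \<Longrightarrow> ?a n \<le> ennreal (C / sqrt (real n))"
    using size by (rule size_minus_half_bound) blast
  have varpi: "varpi_coeff M \<F> q p n \<le> ennreal (C / sqrt (real n))" if "1 \<le> n" for n
    using a[OF that] by (rule order_trans[rotated]) simp
  \<comment> \<open>Since \<open>1 / \<theta> \<ge> 1\<close>, taking this power of a rate
    \<open>n^(-1/2)\<close> preserves it up to the constant.\<close>
  have "\<theta> \<le> 1"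
    using theta const(4) params(1) by (smt (verit) divide_nonneg_nonneg of_nat_0_le_iff)
  define C' where "C' = C powr (1 / \<theta>)"
  have C': "0 < C'"
    using C by (simp add: C'_def)
  have beta: "beta_coeff M \<F> X q n \<le> ennreal (C' / sqrt (real n))" if n: "1 \<le> n" for n
  proof -
    have "ennpowr (beta_coeff M \<F> X q n) \<theta> \<le> ennreal (C / sqrt (real n))"
      using a[OF n] by (rule order_trans[rotated]) simp
    then have "beta_coeff M \<F> X q n \<le> ennreal ((C / sqrt (real n)) powr (1 / \<theta>))"
      using C n params(3) by (intro ennpowr_le_imp_le) auto
    also have "\<dots> \<le> ennreal (C' / sqrt (real n))"
    proof (rule ennreal_leI)
      have "(1 / sqrt (real n)) powr (1 / \<theta>) \<le> (1 / sqrt (real n)) powr 1"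
        using n \<open>\<theta> \<le> 1\<close> params(3) by (intro powr_mono') auto
      then have "C' * (1 / sqrt (real n)) powr (1 / \<theta>) \<le> C' * (1 / sqrt (real n))"
        using n C' by (intro mult_left_mono) auto
      then show "(C / sqrt (real n)) powr (1 / \<theta>) \<le> C' / sqrt (real n)"
        using C n by (simp add: C'_def powr_divide)
    qed
    finally show ?thesis .
  qed
  define V where "V s r = vec_cond_exp M (\<F> (enat (s - r)) (enat (s + r))) (X s)" for s r
  have sub: "subalgebra M (\<F> k l)" if "k \<le> l" for k l
    using family that by (auto simp: sigma_family_def)
  have V_F: "V s r \<in> borel_measurable (\<F> (enat (s - r)) (enat (s + r)))" for s r
    unfolding V_def by (rule vec_cond_exp_measurable)
  have V_M: "V s r \<in> borel_measurable M" for s r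
    by (rule measurable_from_subalg[OF sub V_F]) simp
  \<comment> \<open>The factor 2 is the cost of \<open>nn_integral_norm_le_Lr_norm\<close>.\<close>
  define D where "D = 2 * max C C'"
  interpret nonconventional_averages M X V \<F> \<mu> D l qs \<epsilon>
  proof
    show "X n \<in> borel_measurable M" "distr M borel (X n) = \<mu>" for n
      by (fact X_meas X_distr)+
    show "0 \<le> D"
      using C by (simp add: D_def)
    show "subalgebra M (\<F> k l)" if "k \<le> l" for k l
      using that by (rule sub)
    show "sets (\<F> k l) \<subseteq> sets (\<F> k' l')" if "k \<le> l" "k' \<le> k" "l \<le> l'" for k l k' l'
      using family[unfolded sigma_family_def, THEN conjunct2, THEN conjunct2, rule_format, of k l k' l'] that
      by simp
    show "V s r \<in> borel_measurable (\<F> (enat (s - r)) (enat (s + r)))" for s r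
      by (rule V_F)
    show "(\<integral>\<^sup>+\<omega>. ennreal (norm (X s \<omega> - V s r \<omega>)) \<partial>M) \<le> ennreal (D / sqrt (real r))" if r: "1 \<le> r" for s r
    proof -
      have "Lr_norm M q (\<lambda>\<omega>. X s \<omega> - V s r \<omega>) \<le> beta_coeff M \<F> X q r"
        unfolding V_def beta_coeff_def by (rule SUP_upper) simp
      also have "\<dots> \<le> ennreal (C' / sqrt (real r))"
        using r by (rule beta)
      finally have "(\<integral>\<^sup>+\<omega>. ennreal (norm (X s \<omega> - V s r \<omega>)) \<partial>M) \<le> ennreal (2 * (C' / sqrt (real r)))"
        using X_meas V_M C' r params by (intro nn_integral_norm_le_Lr_norm[OF prob]) auto
      also have "\<dots> \<le> ennreal (D / sqrt (real r))"
        by (intro ennreal_leI) (auto simp: D_def intro!: divide_right_mono)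
      finally show ?thesis .
    qed
    show "(\<integral>\<^sup>+\<omega>. ennreal \<bar>real_cond_exp M (\<F> 0 (enat j)) g \<omega> - integral\<^sup>L M g\<bar> \<partial>M) \<le> ennreal (D / sqrt (real n))"
      if n: "1 \<le> n" and g: "g \<in> borel_measurable (\<F> (enat (j + n)) \<infinity>)" "\<And>\<omega>. \<bar>g \<omega>\<bar> \<le> 1" for n j g
    proof -
      have "real_cond_exp M (\<F> 0 (enat j)) g \<in> borel_measurable M"
        by (rule measurable_from_subalg[OF sub borel_measurable_cond_exp]) simp
      then have meas: "(\<lambda>\<omega>. norm (real_cond_exp M (\<F> 0 (enat j)) g \<omega> - integral\<^sup>L M g)) \<in> borel_measurable M"
        by simp
      have "Lr_norm M p (\<lambda>\<omega>. real_cond_exp M (\<F> 0 (enat j)) g \<omega> - integral\<^sup>L M g)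
          \<le> varpi_alg M q p (\<F> 0 (enat j)) (\<F> (enat (j + n)) \<infinity>)"
        unfolding varpi_alg_def using g params(2) by (intro SUP_upper CollectI conjI Lr_norm_le_1 prob) auto
      also have "\<dots> \<le> varpi_coeff M \<F> q p n"
        unfolding varpi_coeff_def by (rule SUP_upper) simp
      also have "\<dots> \<le> ennreal (C / sqrt (real n))"
        using n by (rule varpi)
      finally have "(\<integral>\<^sup>+\<omega>. ennreal (norm (real_cond_exp M (\<F> 0 (enat j)) g \<omega> - integral\<^sup>L M g)) \<partial>M)
          \<le> ennreal (2 * (C / sqrt (real n)))"
        using meas C n params by (intro nn_integral_norm_le_Lr_norm[OF prob]) auto
      also have "\<dots> \<le> ennreal (D / sqrt (real n))"
        by (intro ennreal_leI) (auto simp: D_def intro!: divide_right_mono)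
      finally show ?thesis
        by simp
    qed
  qed (use l eps qs_less qs_gap qs_step in auto)
  \<comment> \<open>An integer with \<open>\<iota> + 1 \<le> t\<close> for the truncation and
    \<open>t + 1 \<le> \<iota> + 3 \<le> 2 * (\<iota> + 2) \<le> m\<close> for the moment of order
    \<open>t + 1\<close>.\<close>
  define t where "t = nat \<lceil>\<iota>\<rceil> + 1"
  have t: "\<iota> + 1 \<le> real t" "real (Suc t) \<le> \<iota> + 3"
    using const(1) by (simp_all add: t_def) linarith+
  have m: "2 * (\<iota> + 2) \<le> m"
  proof -
    have "0 \<le> 1 / p" "0 \<le> \<theta> / q"
      using params by auto
    then have "(\<iota> + 2) / m \<le> 1 / 2"
      using exponents by linarith
    then show ?thesis
      using params(4) by (simp add: field_simps)
  qed
  have moment: "integrable \<mu> (\<lambda>x. norm x ^ Suc t)"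
  proof (rule integrableI_bounded)
    have "Lr_norm \<mu> m (\<lambda>x. x) < \<top>"
      using moments by (auto simp: gamma_moment_def)
    then have fin: "(\<integral>\<^sup>+x. ennreal (norm x powr m) \<partial>\<mu>) < \<top>"
      by (auto simp: Lr_norm_def ennpowr_def less_top split: if_splits)
    have le: "norm x ^ Suc t \<le> 1 + norm x powr m" for x :: "real ^ 'd"
    proof (cases "norm x \<le> 1")
      case True
      then show ?thesis
        by (intro add_increasing2 power_le_one) auto
    next
      case False
      then have "norm x ^ Suc t = norm x powr real (Suc t)"
        by (subst powr_realpow) auto
      also have "\<dots> \<le> norm x powr m"
        using False t(2) m const(1) by (intro powr_mono) auto
      finally show ?thesis
        by simp
    qed
    interpret mu: prob_space \<mu>
      by (rule prob_space_mu)
    have "(\<integral>\<^sup>+x. ennreal (norm (norm x ^ Suc t)) \<partial>\<mu>) \<le> (\<integral>\<^sup>+x. 1 + ennreal (norm x powr m) \<partial>\<mu>)"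
      using le by (intro nn_integral_mono) (simp del: power_Suc flip: ennreal_1 ennreal_plus)
    also have "\<dots> = 1 + (\<integral>\<^sup>+x. ennreal (norm x powr m) \<partial>\<mu>)"
      by (subst nn_integral_add) (auto simp: mu.emeasure_space_1)
    also have "\<dots> < \<infinity>"
      using fin by simp
    finally show "(\<integral>\<^sup>+x. ennreal (norm (norm x ^ Suc t)) \<partial>\<mu>) < \<infinity>" .
  qed simp
  have "slln F"
    using less_imp_le[OF const(1)] less_imp_le[OF const(2)] const(3) F_hoelder F_growth t(1) moment
    by (rule slln_locally_hoelder)
  then show ?thesis
    by (simp only: slln_def)
qed

end
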